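(* For every $w\in\Sigma_{N+1}$, with the objects attached in the context to the data $N,d,z_1,\dots,z_n,\mathbf a(z_1),\dots,\mathbf a(z_n),\mathbf a(\infty)$ and $w$, the subschemes $\tilde{\mathcal A}_w$ and $\tilde{\mathcal A}'_w$ of $\tilde R^o_w$ coincide.
   Context: Schemes are algebraic schemes over $\mathbb C$. $\Sigma_k$ is the permutation group of $\{1,\dots,k\}$; $\mathbb C_d[x]$ is the space of polynomials of degree $\le d$ (it is $0$, with empty projectivization, if $d<0$); $\mathrm{Wr}(f,g)=fg'-f'g$. Fix integers $0\le N\le d$. A ramification sequence is $\mathbf a=(a_1\ge\dots\ge a_{N+1}\ge0)$ with $a_1\le d-N$; $|\mathbf a|=\sum a_i$. Fix distinct $z_1,\dots,z_n\in\mathbb C$ and ramification sequences $\mathbf a(z_1),\dots,\mathbf a(z_n),\mathbf a(\infty)$ with $\sum_s|\mathbf a(z_s)|+|\mathbf a(\infty)|=(N+1)(d-N)$. Put $K_0=1$, $K_i=\prod_s(x-z_s)^{\sum_{\ell=1}^i a_{N+1-i+\ell}(z_s)}$ ($1\le i\le N+1$) and $T_i=K_{i+1}K_{i-1}/K_i^2=\prod_s(x-z_s)^{a_{N+1-i}(z_s)-a_{N+2-i}(z_s)}$ ($1\le i\le N$). Let $c_1>\dots>c_{N+1}$ be the elements of $\{d-(N+1)+j-a_j(\infty): j=1,\dots,N+1\}$. For $w\in\Sigma_{N+1}$ put $l^w_i=\sum_{j=1}^i c_{w(j)}-i(i-1)/2-\deg K_i$. Let $R_w=\prod_{i=1}^N\mathbb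 P(\mathbb C_{l^w_i}[x])$, and let $R_w^o\subset R_w$ be the open subscheme of $(y_1,\dots,y_N)$ such that, for all $i$, $\deg y_i=l^w_i$, $y_i$ has no roots in $\{z_1,\dots,z_n\}$, $y_i,y_{i+1}$ have no common roots, and $y_i$ has no multiple roots. With $y_0=y_{N+1}=1$, $\mathcal A_w\subset R^o_w$ is the closed subscheme defined by: $y_i$ divides $\mathrm{Wr}(y_i',T_iy_{i-1}y_{i+1})$ for $i=1,\dots,N$ (equations: vanishing of the coefficients of the remainder of long division by $y_i$). Let $\tilde R_w=\prod_{i=1}^N\mathbb C^{l^w_i}$ with coordinates $(t^{(i)}_j)$, $1\le i\le N$, $1\le j\le l^w_i$, and $\Gamma:\tilde R_w\to R_w$, $(t^{(i)}_j)\mapsto(y_1,\dots,y_N)$, $y_i=\prod_{j=1}^{l^w_i}(x-t^{(i)}_j)$. (If some $l_i^w<0$, $R_w$ and $\tilde R_w$ are understood to be empty.) Put $\tilde{\mathcal A}_w=\Gamma^{-1}(\mathcal A_w)$ (scheme-theoretic). It lies in the open subset $\tilde R^o_w\subset\tilde R_w$ of points such that for every $i$: the numbers $t^{(i)}_1,\dots,t^{(i)}_{l^w_i}$ are distinct; $\{t^{(i)}_j\}_j$ and $\{t^{(i+1)}_k\}_k$ are disjoint; $\{t^{(i)}_j\}_j$ and $\{z_1,\dots,z_n\}$ are disjoint. On $\tilde R^o_w$ consider the regular function (master function) $$\Phi_w=\prod_{i=1}^N\prod_{j=1}^{l^w_i}T_i(t^{(i)}_j)^{-1}\prod_{i=1}^{N-1}\prod_{j=1}^{l^w_i}\prod_{k=1}^{l^w_{i+1}}(t^{(i)}_j-t^{(i+1)}_k)^{-1}\prod_{i=1}^N\prod_{1\le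 j<k\le l^w_i}(t^{(i)}_j-t^{(i)}_k)^2.$$ $\tilde{\mathcal A}'_w\subset\tilde R^o_w$ is the subscheme of critical points of $\Phi_w$, defined by the vanishing of all first partial derivatives of $\Phi_w$. *)

theory Defs
  imports
    "HOL-Algebra.Ideal"
    "HOL-Analysis.Derivative"
    "HOL-Combinatorics.Permutations"
    "HOL-Computational_Algebra.Polynomial_Factorial"
    "HOL-Library.FuncSet"
begin

text \<open>All ambient varieties below are reduced, so a regular function is identified with the
  complex-valued function it induces on closed points. Functions on \<open>U\<close> are normalised
  by being extensional on \<open>U\<close>, so that equality of functions is equality on \<open>U\<close>.\<close>

inductive_set poly_funs :: "'v set \<Rightarrow> (('v \<Rightarrow> complex) \<Rightarrow> complex) set" for I :: "'v set" where
  const: "(\<lambda>_. c) \<in> poly_funs I"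
| coord: "v \<in> I \<Longrightarrow> (\<lambda>x. x v) \<in> poly_funs I"
| add: "p \<in> poly_funs I \<Longrightarrow> q \<in> poly_funs I \<Longrightarrow> (\<lambda>x. p x + q x) \<in> poly_funs I"
| mult: "p \<in> poly_funs I \<Longrightarrow> q \<in> poly_funs I \<Longrightarrow> (\<lambda>x. p x * q x) \<in> poly_funs I"

text \<open>Regular functions on an open subset \<open>U\<close> of the affine space with coordinates indexed by
  \<open>I\<close>: functions that are locally, in the Zariski topology, quotients of polynomials.\<close>

definition regular_affine ::
    "'v set \<Rightarrow> ('v \<Rightarrow> complex) set \<Rightarrow> (('v \<Rightarrow> complex) \<Rightarrow> complex) set" where
  "regular_affine I U =
     {f \<in> extensional U. \<forall>x\<in>U. \<exists>p\<in>poly_funs I. \<exists>q\<in>poly_funs I.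
        q x \<noteq> 0 \<and> (\<forall>y\<in>U. q y \<noteq> 0 \<longrightarrow> f y = p y / q y)}"

definition function_ring :: "'p set \<Rightarrow> ('p \<Rightarrow> complex) set \<Rightarrow> ('p \<Rightarrow> complex) ring" where
  "function_ring U F =
     \<lparr>carrier = F,
      monoid.mult = (\<lambda>f g. \<lambda>x\<in>U. f x * g x),
      one = (\<lambda>x\<in>U. 1),
      zero = (\<lambda>x\<in>U. 0),
      add = (\<lambda>f g. \<lambda>x\<in>U. f x + g x)\<rparr>"

text \<open>A closed subscheme of an affine variety is the same thing as an ideal of its coordinate ring.
  A subscheme which is closed in an affine open \<open>U\<close> is therefore represented by \<open>U\<close> (its set of
  closed points) together with the ideal of the subscheme in the ring of regular functions
  on \<open>U\<close>.\<close>

type_synonym 'p subscheme = "'p set \<times> ('p \<Rightarrow> complex) set"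

definition closed_subscheme ::
    "'p set \<Rightarrow> ('p \<Rightarrow> complex) set \<Rightarrow> ('p \<Rightarrow> complex) set \<Rightarrow> 'p subscheme" where
  "closed_subscheme U F S = (U, Idl\<^bsub>function_ring U F\<^esub> S)"

definition polys_upto :: "int \<Rightarrow> complex poly set" where
  "polys_upto e = {p. p = 0 \<or> int (degree p) \<le> e}"

definition line :: "complex poly \<Rightarrow> complex poly set" where
  "line p = {smult c p | c. True}"

definition projectivization :: "complex poly set \<Rightarrow> complex poly set set" where
  "projectivization V = line ` (V - {0})"

text \<open>The point \<open>(y\<^sub>1, \<dots>, y\<^sub>N)\<close> of the product is the family of lines spanned by the \<open>y\<^sub>i\<close>.\<close>

definition R_space :: "nat \<Rightarrow> (nat \<Rightarrow> int) \<Rightarrow> (nat \<Rightarrow> complex poly set) set" where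
  "R_space N l = (\<Pi>\<^sub>E i\<in>{1..N}. projectivization (polys_upto (l i)))"

definition R_index :: "nat \<Rightarrow> (nat \<Rightarrow> int) \<Rightarrow> (nat \<times> nat) set" where
  "R_index N l = {(i, k). i \<in> {1..N} \<and> int k \<le> l i}"

text \<open>Homogeneous coordinate vectors of a point: the coefficients of any choice of spanning
  vectors.\<close>

definition hom_coords :: "nat \<Rightarrow> (nat \<Rightarrow> complex poly set) \<Rightarrow> (nat \<times> nat \<Rightarrow> complex) set" where
  "hom_coords N \<eta> = {(\<lambda>(i, k). coeff (y i) k) | y. \<forall>i\<in>{1..N}. y i \<in> \<eta> i - {0}}"

definition multihom_polys ::
    "nat \<Rightarrow> (nat \<Rightarrow> int) \<Rightarrow> (nat \<Rightarrow> nat) \<Rightarrow> ((nat \<times> nat \<Rightarrow> complex) \<Rightarrow> complex) set" where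
  "multihom_polys N l e =
     {p \<in> poly_funs (R_index N l).
        \<forall>\<mu> c. p (\<lambda>(i, k). \<mu> i * c (i, k)) = (\<Prod>i=1..N. \<mu> i ^ e i) * p c}"

text \<open>Regular functions on an open subset of the product: locally quotients of multihomogeneous
  polynomials of equal multidegree.\<close>

definition regular_R ::
    "nat \<Rightarrow> (nat \<Rightarrow> int) \<Rightarrow> (nat \<Rightarrow> complex poly set) set
      \<Rightarrow> ((nat \<Rightarrow> complex poly set) \<Rightarrow> complex) set" where
  "regular_R N l U =
     {f \<in> extensional U. \<forall>\<eta>\<in>U. \<exists>e. \<exists>p\<in>multihom_polys N l e. \<exists>q\<in>multihom_polys N l e.
        (\<forall>c\<in>hom_coords N \<eta>. q c \<noteq> 0) \<and>
        (\<forall>\<theta>\<in>U. \<forall>c\<in>hom_coords N \<theta>. q c \<noteq> 0 \<longrightarrow> f \<theta> = p c / q c)}"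

text \<open>The monic representatives \<open>y\<^sub>i\<close> of a point, with the convention \<open>y\<^sub>0 = y\<^sub>N\<^sub>+\<^sub>1 = 1\<close>.\<close>

definition monic_rep :: "nat \<Rightarrow> (nat \<Rightarrow> complex poly set) \<Rightarrow> nat \<Rightarrow> complex poly" where
  "monic_rep N \<eta> i = (if i \<in> {1..N} then (THE p. p \<in> \<eta> i \<and> lead_coeff p = 1) else 1)"

definition R_open ::
    "nat \<Rightarrow> (nat \<Rightarrow> int) \<Rightarrow> complex set \<Rightarrow> (nat \<Rightarrow> complex poly set) set" where
  "R_open N l Z =
     {\<eta> \<in> R_space N l. let y = monic_rep N \<eta> in
        \<forall>i\<in>{1..N}. int (degree (y i)) = l i
          \<and> (\<forall>x\<in>Z. poly (y i) x \<noteq> 0)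
          \<and> \<not> (\<exists>x. poly (y i) x = 0 \<and> poly (y (i + 1)) x = 0)
          \<and> rsquarefree (y i)}"

definition Wr :: "complex poly \<Rightarrow> complex poly \<Rightarrow> complex poly" where
  "Wr f g = f * pderiv g - pderiv f * g"

text \<open>On \<open>R_open\<close> the degree of \<open>y\<^sub>i\<close> is constant, so the coefficients of the remainder, computed
  with monic representatives, are regular functions. \<open>R_open\<close> is affine: it is the complement,
  in the affine space of tuples of monic polynomials, of the zeros of values at \<open>Z\<close>,
  resultants and discriminants.\<close>

definition A_scheme ::
    "nat \<Rightarrow> (nat \<Rightarrow> int) \<Rightarrow> complex set \<Rightarrow> (nat \<Rightarrow> complex poly)
      \<Rightarrow> (nat \<Rightarrow> complex poly set) subscheme" where
  "A_scheme N l Z T =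
     closed_subscheme (R_open N l Z) (regular_R N l (R_open N l Z))
       {(\<lambda>\<eta>\<in>R_open N l Z. let y = monic_rep N \<eta> in
           coeff (Wr (pderiv (y i)) (T i * y (i - 1) * y (i + 1)) mod y i) k)
        | i k. i \<in> {1..N}}"

definition Rt_index :: "nat \<Rightarrow> (nat \<Rightarrow> int) \<Rightarrow> (nat \<times> nat) set" where
  "Rt_index N l = {(i, j). i \<in> {1..N} \<and> 1 \<le> j \<and> int j \<le> l i}"

definition Rt_space :: "nat \<Rightarrow> (nat \<Rightarrow> int) \<Rightarrow> (nat \<times> nat \<Rightarrow> complex) set" where
  "Rt_space N l = (if \<forall>i\<in>{1..N}. 0 \<le> l i then Rt_index N l \<rightarrow>\<^sub>E UNIV else {})"

definition Gamma_map ::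
    "nat \<Rightarrow> (nat \<Rightarrow> int) \<Rightarrow> (nat \<times> nat \<Rightarrow> complex) \<Rightarrow> nat \<Rightarrow> complex poly set" where
  "Gamma_map N l t = (\<lambda>i\<in>{1..N}. line (\<Prod>j\<in>{1..nat (l i)}. [:- t (i, j), 1:]))"

text \<open>Scheme-theoretic preimage under \<open>\<Gamma>\<close> of a subscheme \<open>X\<close> that is closed in an affine open set:
  the ideal is generated by the pullbacks of the functions in the ideal of \<open>X\<close>.
  For \<open>X = A_scheme\<close> the open set \<open>U\<close> is \<open>Rt_open\<close>.\<close>

definition Gamma_preimage ::
    "nat \<Rightarrow> (nat \<Rightarrow> int) \<Rightarrow> (nat \<Rightarrow> complex poly set) subscheme
      \<Rightarrow> (nat \<times> nat \<Rightarrow> complex) subscheme" where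
  "Gamma_preimage N l X =
     (let U = {t \<in> Rt_space N l. Gamma_map N l t \<in> fst X} in
      closed_subscheme U (regular_affine (Rt_index N l) U)
        {(\<lambda>t\<in>U. f (Gamma_map N l t)) | f. f \<in> snd X})"

definition At_scheme ::
    "nat \<Rightarrow> (nat \<Rightarrow> int) \<Rightarrow> complex set \<Rightarrow> (nat \<Rightarrow> complex poly)
      \<Rightarrow> (nat \<times> nat \<Rightarrow> complex) subscheme" where
  "At_scheme N l Z T = Gamma_preimage N l (A_scheme N l Z T)"

definition Rt_open ::
    "nat \<Rightarrow> (nat \<Rightarrow> int) \<Rightarrow> complex set \<Rightarrow> (nat \<times> nat \<Rightarrow> complex) set" where
  "Rt_open N l Z =
     {t \<in> Rt_space N l. \<forall>i\<in>{1..N}.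
        inj_on (\<lambda>j. t (i, j)) {1..nat (l i)}
        \<and> (i < N \<longrightarrow>
             (\<lambda>j. t (i, j)) ` {1..nat (l i)} \<inter> (\<lambda>k. t (i + 1, k)) ` {1..nat (l (i + 1))} = {})
        \<and> (\<lambda>j. t (i, j)) ` {1..nat (l i)} \<inter> Z = {}}"

definition master_fun ::
    "nat \<Rightarrow> (nat \<Rightarrow> int) \<Rightarrow> (nat \<Rightarrow> complex poly) \<Rightarrow> (nat \<times> nat \<Rightarrow> complex) \<Rightarrow> complex" where
  "master_fun N l T t =
     (\<Prod>i\<in>{1..N}. \<Prod>j\<in>{1..nat (l i)}. inverse (poly (T i) (t (i, j))))
   * (\<Prod>i\<in>{1..<N}. \<Prod>j\<in>{1..nat (l i)}. \<Prod>k\<in>{1..nat (l (i + 1))}.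
        inverse (t (i, j) - t (i + 1, k)))
   * (\<Prod>i\<in>{1..N}. \<Prod>j\<in>{1..nat (l i)}. \<Prod>k\<in>{j<..nat (l i)}. (t (i, j) - t (i, k))\<^sup>2)"

definition partial_deriv ::
    "'v \<Rightarrow> (('v \<Rightarrow> complex) \<Rightarrow> complex) \<Rightarrow> ('v \<Rightarrow> complex) \<Rightarrow> complex" where
  "partial_deriv v f t = deriv (\<lambda>u. f (t(v := u))) (t v)"

definition At'_scheme ::
    "nat \<Rightarrow> (nat \<Rightarrow> int) \<Rightarrow> complex set \<Rightarrow> (nat \<Rightarrow> complex poly)
      \<Rightarrow> (nat \<times> nat \<Rightarrow> complex) subscheme" where
  "At'_scheme N l Z T =
     closed_subscheme (Rt_open N l Z) (regular_affine (Rt_index N l) (Rt_open N l Z))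
       {(\<lambda>t\<in>Rt_open N l Z. partial_deriv v (master_fun N l T) t) | v. v \<in> Rt_index N l}"

text \<open>A ramification sequence is given by its values at the indices \<open>1, \<dots>, N + 1\<close>; other values
  are irrelevant. \<open>a s\<close> is the sequence at \<open>z s\<close>.\<close>

definition ramification_seq :: "nat \<Rightarrow> nat \<Rightarrow> (nat \<Rightarrow> nat) \<Rightarrow> bool" where
  "ramification_seq N d a \<longleftrightarrow> (\<forall>j\<in>{1..N}. a (j + 1) \<le> a j) \<and> a 1 \<le> d - N"

definition ram_size :: "nat \<Rightarrow> (nat \<Rightarrow> nat) \<Rightarrow> nat" where
  "ram_size N a = (\<Sum>j=1..N + 1. a j)"

definition K_poly ::
    "nat \<Rightarrow> nat \<Rightarrow> (nat \<Rightarrow> complex) \<Rightarrow> (nat \<Rightarrow> nat \<Rightarrow> nat) \<Rightarrow> nat \<Rightarrow> complex poly" where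
  "K_poly N n z a i = (\<Prod>s=1..n. [:- z s, 1:] ^ (\<Sum>m=1..i. a s (N + 1 - i + m)))"

definition T_poly ::
    "nat \<Rightarrow> nat \<Rightarrow> (nat \<Rightarrow> complex) \<Rightarrow> (nat \<Rightarrow> nat \<Rightarrow> nat) \<Rightarrow> nat \<Rightarrow> complex poly" where
  "T_poly N n z a i = (\<Prod>s=1..n. [:- z s, 1:] ^ (a s (N + 1 - i) - a s (N + 2 - i)))"

lemma T_poly_K_poly:
  assumes "\<And>s. s \<in> {1..n} \<Longrightarrow> ramification_seq N d (a s)" and i: "i \<in> {1..N}"
  shows "T_poly N n z a i * (K_poly N n z a i)\<^sup>2 = K_poly N n z a (i + 1) * K_poly N n z a (i - 1)"
proof -
  have "(a s (N + 1 - i) - a s (N + 2 - i)) + 2 * (\<Sum>m=1..i. a s (N + 1 - i + m))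
      = (\<Sum>m=1..i + 1. a s (N + 1 - (i + 1) + m)) + (\<Sum>m=1..i - 1. a s (N + 1 - (i - 1) + m))"
    if s: "s \<in> {1..n}" for s
  proof -
    have "a s (Suc (N + 1 - i)) \<le> a s (N + 1 - i)"
      using assms(1)[OF s] i unfolding ramification_seq_def by fastforce
    moreover have "(\<Sum>m=1..i + 1. a s (N + 1 - (i + 1) + m))
        = a s (N + 1 - i) + (\<Sum>m=1..i. a s (N + 1 - i + m))"
      using i by (subst sum.atLeast_Suc_atMost_Suc_shift[symmetric] sum.atLeast_Suc_atMost;
        simp add: sum.atLeast_Suc_atMost sum.shift_bounds_cl_Suc_ivl Suc_diff_le del: sum.cl_ivl_Suc)
    moreover have "(\<Sum>m=1..i. a s (N + 1 - i + m))
        = a s (N + 2 - i) + (\<Sum>m=1..i - 1. a s (N + 1 - (i - 1) + m))"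
    proof -
      obtain i' where i': "i = Suc i'" using i by (cases i) auto
      show ?thesis using i unfolding i'
        by (simp add: sum.atLeast_Suc_atMost sum.shift_bounds_cl_Suc_ivl Suc_diff_le
            del: sum.cl_ivl_Suc)
    qed
    ultimately show ?thesis using i by (simp add: Suc_diff_le)
  qed
  then have "(\<Prod>s=1..n. [:- z s, 1:] ^ ((a s (N + 1 - i) - a s (N + 2 - i))
        + 2 * (\<Sum>m=1..i. a s (N + 1 - i + m))))
      = (\<Prod>s=1..n. [:- z s, 1:] ^ ((\<Sum>m=1..i + 1. a s (N + 1 - (i + 1) + m))
        + (\<Sum>m=1..i - 1. a s (N + 1 - (i - 1) + m))))"
    by (intro prod.cong refl arg_cong2[where f = power]) blast
  then show ?thesis
    unfolding T_poly_def K_poly_def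
    by (simp only: power_add prod.distrib prod_power_distrib power_mult[symmetric] mult.commute[of 2])
qed

text \<open>The \<open>j\<close>-th largest element of the set of exponents at infinity.\<close>

definition c_seq :: "nat \<Rightarrow> nat \<Rightarrow> (nat \<Rightarrow> nat) \<Rightarrow> nat \<Rightarrow> int" where
  "c_seq N d ainf j =
     rev (sorted_list_of_set ((\<lambda>m. int d - (int N + 1) + int m - int (ainf m)) ` {1..N + 1})) ! (j - 1)"

definition lw ::
    "nat \<Rightarrow> nat \<Rightarrow> nat \<Rightarrow> (nat \<Rightarrow> complex) \<Rightarrow> (nat \<Rightarrow> nat \<Rightarrow> nat) \<Rightarrow> (nat \<Rightarrow> nat)
      \<Rightarrow> (nat \<Rightarrow> nat) \<Rightarrow> nat \<Rightarrow> int" where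
  "lw N d n z a ainf w i =
     (\<Sum>j=1..i. c_seq N d ainf (w j)) - int (i * (i - 1) div 2) - int (degree (K_poly N n z a i))"

end

theory Submission
  imports Defs
begin

text \<open>Let \<open>Q\<^sub>i = T\<^sub>i y\<^sub>i\<^sub>-\<^sub>1 y\<^sub>i\<^sub>+\<^sub>1\<close> and let \<open>r\<^sub>i\<close> be the remainder of \<open>Wr(y\<^sub>i', Q\<^sub>i)\<close> modulo \<open>y\<^sub>i\<close>. At a root
  \<open>u\<close> of \<open>y\<^sub>i\<close> the logarithmic derivative of the master function in the coordinate \<open>u\<close> is
  \<open>y\<^sub>i''/y\<^sub>i' - Q\<^sub>i'/Q\<^sub>i = - r\<^sub>i(u) / (y\<^sub>i'(u) Q\<^sub>i(u))\<close>, so the partial derivatives agree with the values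
  \<open>r\<^sub>i(u)\<close> up to units of the coordinate ring. As the roots of \<open>y\<^sub>i\<close> are distinct and \<open>deg r\<^sub>i < deg y\<^sub>i\<close>,
  Lagrange interpolation shows that the values of \<open>r\<^sub>i\<close> at the roots and the coefficients of \<open>r\<^sub>i\<close> generate
  the same ideal. Finally, the ideal of \<open>\<A>\<^sub>w\<close> can be replaced by its generators before pulling back
  along \<open>\<Gamma>\<close>, because pulling back is a ring homomorphism.\<close>

section \<open>Rings of functions and their ideals\<close>

lemma poly_altdef_le:
  fixes x :: "'a::comm_semiring_1"
  assumes "degree p \<le> m"
  shows "poly p x = (\<Sum>k\<le>m. coeff p k * x ^ k)"
proof -
  have "(\<Sum>k\<le>m. coeff p k * x ^ k) = (\<Sum>k\<le>degree p. coeff p k * x ^ k)"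
    using assms by (intro sum.mono_neutral_right) (auto simp: coeff_eq_0)
  then show ?thesis by (simp only: poly_altdef)
qed

text \<open>A subalgebra of the complex-valued functions on \<open>U\<close>. The polynomial
  functions, the regular functions on an affine open set and the regular functions on an open subset
  of the product of projective spaces are all instances, so one calculus serves the three of
  them.\<close>

locale function_algebra =
  fixes U :: "'p set" and F :: "('p \<Rightarrow> complex) set"
  assumes subset_extensional: "F \<subseteq> extensional U"
    and const_mem: "(\<lambda>x\<in>U. c) \<in> F"
    and add_mem: "f \<in> F \<Longrightarrow> g \<in> F \<Longrightarrow> (\<lambda>x\<in>U. f x + g x) \<in> F"
    and mult_mem: "f \<in> F \<Longrightarrow> g \<in> F \<Longrightarrow> (\<lambda>x\<in>U. f x * g x) \<in> F"
begin

text \<open>Ignoring the values outside \<open>U\<close> allows regularity to be proved for plain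
  lambda terms, without a restriction at every intermediate step.\<close>

definition reg :: "('p \<Rightarrow> complex) \<Rightarrow> bool" where
  "reg f \<longleftrightarrow> restrict f U \<in> F"

lemma reg_if_mem: "f \<in> F \<Longrightarrow> reg f"
  using subset_extensional by (metis extensional_restrict reg_def subsetD)

lemma reg_cong: "(\<And>x. x \<in> U \<Longrightarrow> f x = g x) \<Longrightarrow> reg f \<longleftrightarrow> reg g"
  unfolding reg_def using restrict_ext by metis

lemma reg_const [intro!, simp]: "reg (\<lambda>_. c)"
  by (simp add: reg_def const_mem)

lemma reg_add [intro!]:
  assumes "reg f" "reg g" shows "reg (\<lambda>x. f x + g x)"
proof -
  have "(\<lambda>x\<in>U. restrict f U x + restrict g U x) = (\<lambda>x\<in>U. f x + g x)" by (rule restrict_ext) simp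
  then show ?thesis using add_mem assms unfolding reg_def by metis
qed

lemma reg_mult [intro!]:
  assumes "reg f" "reg g" shows "reg (\<lambda>x. f x * g x)"
proof -
  have "(\<lambda>x\<in>U. restrict f U x * restrict g U x) = (\<lambda>x\<in>U. f x * g x)" by (rule restrict_ext) simp
  then show ?thesis using mult_mem assms unfolding reg_def by metis
qed

lemma reg_uminus [intro!]: "reg f \<Longrightarrow> reg (\<lambda>x. - f x)"
  using reg_mult[of "\<lambda>_. -1" f] by simp

lemma reg_diff [intro!]: "reg f \<Longrightarrow> reg g \<Longrightarrow> reg (\<lambda>x. f x - g x)"
  using reg_add[OF _ reg_uminus, of f g] by simp

lemma reg_sum [intro!]: "(\<And>j. j \<in> J \<Longrightarrow> reg (f j)) \<Longrightarrow> reg (\<lambda>x. \<Sum>j\<in>J. f j x)"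
  by (induction J rule: infinite_finite_induct) auto

lemma reg_prod [intro!]: "(\<And>j. j \<in> J \<Longrightarrow> reg (f j)) \<Longrightarrow> reg (\<lambda>x. \<Prod>j\<in>J. f j x)"
  by (induction J rule: infinite_finite_induct) auto

lemma reg_power [intro!]: "reg f \<Longrightarrow> reg (\<lambda>x. f x ^ m)"
  by (induction m) auto

lemma cring_function_ring: "cring (function_ring U F)"
proof (intro cringI abelian_groupI comm_monoidI)
  fix f assume "f \<in> carrier (function_ring U F)"
  then have f: "f \<in> F" by (simp add: function_ring_def)
  then have "f \<in> extensional U" using subset_extensional by auto
  then show "\<zero>\<^bsub>function_ring U F\<^esub> \<oplus>\<^bsub>function_ring U F\<^esub> f = f"
    "\<one>\<^bsub>function_ring U F\<^esub> \<otimes>\<^bsub>function_ring U F\<^esub> f = f"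
    by (auto simp: function_ring_def extensional_def restrict_def)
  have "(\<lambda>x\<in>U. - f x) \<in> F" using f reg_if_mem reg_uminus reg_def by blast
  then show "\<exists>g\<in>carrier (function_ring U F).
      g \<oplus>\<^bsub>function_ring U F\<^esub> f = \<zero>\<^bsub>function_ring U F\<^esub>"
    by (intro bexI[of _ "\<lambda>x\<in>U. - f x"]) (auto simp: function_ring_def intro: restrict_ext)
qed (auto simp: function_ring_def const_mem add_mem mult_mem algebra_simps intro!: restrict_ext)

lemma a_inv_function_ring:
  assumes "f \<in> F" shows "\<ominus>\<^bsub>function_ring U F\<^esub> f = (\<lambda>x\<in>U. - f x)"
proof -
  interpret cring "function_ring U F" by (rule cring_function_ring)
  have "(\<lambda>x\<in>U. - f x) \<in> F" using assms reg_if_mem reg_uminus reg_def by blast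
  then show ?thesis using assms
    by (intro minus_equality) (auto simp: function_ring_def intro: restrict_ext)
qed

text \<open>Closure under negation comes from multiplication by the constant function
  \<open>-1\<close>, and multiplication on the other side from commutativity. The four remaining
  conditions concern functions only and hide the ring record.\<close>

lemma ideal_function_ring_iff:
  "ideal I (function_ring U F) \<longleftrightarrow> I \<subseteq> F \<and> (\<lambda>x\<in>U. 0) \<in> I
    \<and> (\<forall>f\<in>I. \<forall>g\<in>I. (\<lambda>x\<in>U. f x + g x) \<in> I) \<and> (\<forall>f\<in>I. \<forall>g\<in>F. (\<lambda>x\<in>U. g x * f x) \<in> I)"
  (is "?L \<longleftrightarrow> ?R")
proof
  assume ?L
  then interpret ideal I "function_ring U F" .
  show ?R
    using a_subset additive_subgroup.zero_closed[OF additive_subgroup_axioms]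
      additive_subgroup.a_closed[OF additive_subgroup_axioms] I_l_closed
    by (simp add: function_ring_def)
next
  assume R: ?R
  have uminus: "(\<lambda>x\<in>U. - f x) \<in> I" if "f \<in> I" for f
  proof -
    have "(\<lambda>x\<in>U. (\<lambda>x\<in>U. -1) x * f x) \<in> I" using R that const_mem by blast
    moreover have "(\<lambda>x\<in>U. (\<lambda>x\<in>U. -1) x * f x) = (\<lambda>x\<in>U. - f x)" by (rule restrict_ext) simp
    ultimately show ?thesis by simp
  qed
  interpret cring "function_ring U F" by (rule cring_function_ring)
  show ?L
  proof (rule idealI)
    show "ring (function_ring U F)" by (rule ring_axioms)
    show "subgroup I (add_monoid (function_ring U F))"
    proof (rule add.subgroupI)
      show "I \<subseteq> carrier (function_ring U F)" "I \<noteq> {}"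
        using R by (auto simp: function_ring_def)
      show "\<ominus>\<^bsub>function_ring U F\<^esub> f \<in> I" if "f \<in> I" for f
        using a_inv_function_ring[of f] uminus[OF that] R that by auto
      show "f \<oplus>\<^bsub>function_ring U F\<^esub> g \<in> I" if "f \<in> I" "g \<in> I" for f g
        using R that by (simp add: function_ring_def)
    qed
    show "g \<otimes>\<^bsub>function_ring U F\<^esub> f \<in> I" if "f \<in> I" "g \<in> carrier (function_ring U F)" for f g
      using R that by (simp add: function_ring_def)
    then show "f \<otimes>\<^bsub>function_ring U F\<^esub> g \<in> I" if "f \<in> I" "g \<in> carrier (function_ring U F)" for f g
      using that R m_comm[of f g] by (auto simp: function_ring_def)
  qed
qed

text \<open>Both inclusions between the two ideals are proved in this form: each generator of one
  ideal is written as a combination, with regular coefficients, of generators of the other.\<close>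

lemma ideal_linear_combination:
  assumes I: "ideal I (function_ring U F)"
    and "\<And>j. j \<in> J \<Longrightarrow> reg (g j)" and "\<And>j. j \<in> J \<Longrightarrow> restrict (f j) U \<in> I"
  shows "(\<lambda>x\<in>U. \<Sum>j\<in>J. g j x * f j x) \<in> I"
  using assms(2,3)
proof (induction J rule: infinite_finite_induct)
  case (insert j J)
  have "(\<lambda>x\<in>U. restrict (g j) U x * restrict (f j) U x) \<in> I"
    using I insert.prems unfolding ideal_function_ring_iff reg_def by blast
  then have "(\<lambda>x\<in>U. (\<lambda>x\<in>U. restrict (g j) U x * restrict (f j) U x) x
      + (\<lambda>x\<in>U. \<Sum>j\<in>J. g j x * f j x) x) \<in> I"
    using I insert unfolding ideal_function_ring_iff by blast
  moreover have "(\<lambda>x\<in>U. (\<lambda>x\<in>U. restrict (g j) U x * restrict (f j) U x) x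
      + (\<lambda>x\<in>U. \<Sum>j\<in>J. g j x * f j x) x) = (\<lambda>x\<in>U. \<Sum>j\<in>insert j J. g j x * f j x)"
    by (rule restrict_ext) (simp add: insert.hyps)
  ultimately show ?case by (rule back_subst[where P = "\<lambda>h. h \<in> I"])
qed (use I in \<open>simp_all add: ideal_function_ring_iff\<close>)

lemma ideal_genideal: "S \<subseteq> F \<Longrightarrow> ideal (Idl\<^bsub>function_ring U F\<^esub> S) (function_ring U F)"
  using ring.genideal_ideal[OF cring.axioms(1)[OF cring_function_ring]]
  by (simp add: function_ring_def)

lemma subset_genideal: "S \<subseteq> F \<Longrightarrow> S \<subseteq> Idl\<^bsub>function_ring U F\<^esub> S"
  using ring.genideal_self[OF cring.axioms(1)[OF cring_function_ring]]
  by (simp add: function_ring_def)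

lemma genideal_subset:
  "ideal I (function_ring U F) \<Longrightarrow> S \<subseteq> I \<Longrightarrow> Idl\<^bsub>function_ring U F\<^esub> S \<subseteq> I"
  by (rule ring.genideal_minimal[OF cring.axioms(1)[OF cring_function_ring]])

text \<open>A pointwise substitute for polynomials over the ring \<open>F\<close>: a family of
  complex polynomials parametrized by \<open>U\<close>. The degrees may be unbounded in the family,
  so bounds are required separately where they matter.\<close>

definition preg :: "('p \<Rightarrow> complex poly) \<Rightarrow> bool" where
  "preg Y \<longleftrightarrow> (\<forall>k. reg (\<lambda>x. coeff (Y x) k))"

lemma preg_cong: "(\<And>x. x \<in> U \<Longrightarrow> f x = g x) \<Longrightarrow> preg f \<longleftrightarrow> preg g"
  unfolding preg_def by (intro all_cong1 reg_cong) simp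

lemma preg_const [intro!, simp]: "preg (\<lambda>_. p)"
  by (simp add: preg_def)

lemma preg_diff [intro!]: "preg Y \<Longrightarrow> preg Z \<Longrightarrow> preg (\<lambda>x. Y x - Z x)"
  by (auto simp: preg_def)

lemma preg_mult [intro!]: "preg Y \<Longrightarrow> preg Z \<Longrightarrow> preg (\<lambda>x. Y x * Z x)"
  by (auto simp: preg_def coeff_mult)

lemma preg_prod [intro!]: "(\<And>j. j \<in> J \<Longrightarrow> preg (Y j)) \<Longrightarrow> preg (\<lambda>x. \<Prod>j\<in>J. Y j x)"
  by (induction J rule: infinite_finite_induct) auto

lemma preg_pderiv [intro!]: "preg Y \<Longrightarrow> preg (\<lambda>x. pderiv (Y x))"
  by (auto simp: preg_def coeff_pderiv)

lemma preg_Wr [intro!]: "preg Y \<Longrightarrow> preg Z \<Longrightarrow> preg (\<lambda>x. Wr (Y x) (Z x))"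
  unfolding Wr_def by auto

lemma preg_monom [intro!]:
  assumes "reg f" shows "preg (\<lambda>x. monom (f x) m)"
  unfolding preg_def
proof
  fix k show "reg (\<lambda>x. coeff (monom (f x) m) k)"
    using assms by (cases "m = k") auto
qed

lemma preg_linear [intro!]:
  assumes "reg f" shows "preg (\<lambda>x. [:f x, 1:])"
  unfolding preg_def
proof
  fix k show "reg (\<lambda>x. coeff [:f x, 1:] k)"
    using assms by (cases k) (auto simp: coeff_pCons)
qed

text \<open>Long division by a monic polynomial never divides coefficients, so it stays inside
  \<open>F\<close>. Induction on the common degree bound \<open>m\<close> performs the same number
  of division steps at all points of \<open>U\<close>.\<close>

lemma preg_mod:
  assumes Y: "preg Y" and G: "preg G"
    and deg: "\<And>x. x \<in> U \<Longrightarrow> degree (Y x) \<le> m"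
    and monic: "\<And>x. x \<in> U \<Longrightarrow> degree (G x) = e \<and> lead_coeff (G x) = 1"
  shows "preg (\<lambda>x. Y x mod G x)"
  using Y deg
proof (induction m arbitrary: Y rule: less_induct)
  case (less m)
  consider "m < e" | "e = 0" | "e \<le> m" "e > 0" by linarith
  then show ?case
  proof cases
    case 1
    then have "Y x mod G x = Y x" if "x \<in> U" for x
      using less.prems(2)[OF that] monic[OF that] by (intro mod_poly_less) simp
    then show ?thesis using less.prems(1) preg_cong[of "\<lambda>x. Y x mod G x" Y] by simp
  next
    case 2
    \<comment> \<open>A monic polynomial of degree 0 is 1. With this case set aside,
      \<open>m\<close> is positive in the last case and \<open>m - 1\<close> is really
      smaller.\<close>
    have "Y x mod G x = 0" if x: "x \<in> U" for x
    proof -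
      obtain c where "G x = [:c:]" using monic[OF x] 2 by (metis degree_eq_zeroE)
      then show ?thesis using monic[OF x] by (simp flip: one_pCons)
    qed
    then show ?thesis using preg_cong[of "\<lambda>x. Y x mod G x" "\<lambda>_. 0"] by simp
  next
    case 3
    \<comment> \<open>One step of long division. It removes the coefficient at the bound
      \<open>m\<close>, not at the actual degree of \<open>Y x\<close>, and is therefore given by
      one formula for all \<open>x\<close>.\<close>
    define Y' where "Y' = (\<lambda>x. Y x - monom (coeff (Y x) m) (m - e) * G x)"
    have "preg Y'"
      unfolding Y'_def using less.prems(1) G by (auto simp: preg_def[of Y])
    moreover have "degree (Y' x) \<le> m - 1" if x: "x \<in> U" for x
    proof (rule degree_le, intro allI impI)
      fix k assume k: "m - 1 < k"
      show "coeff (Y' x) k = 0"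
      proof (cases "k = m")
        case True
        then show ?thesis using monic[OF x] 3 by (auto simp: Y'_def coeff_monom_mult)
      next
        case False
        then have "k > m" using k by simp
        then show ?thesis using less.prems(2)[OF x] monic[OF x] 3
          by (simp add: Y'_def coeff_monom_mult coeff_eq_0)
      qed
    qed
    ultimately have "preg (\<lambda>x. Y' x mod G x)" using 3 by (intro less.IH[of "m - 1"]) auto
    moreover have "Y' x mod G x = Y x mod G x" for x
      unfolding Y'_def by (simp add: poly_mod_diff_left)
    ultimately show ?thesis by simp
  qed
qed

text \<open>The uniform degree bound turns evaluation into one sum with a fixed number of terms,
  built from the coefficients and powers of \<open>f\<close>.\<close>

lemma reg_poly:
  assumes "preg Y" "reg f" "\<And>x. x \<in> U \<Longrightarrow> degree (Y x) \<le> m"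
  shows "reg (\<lambda>x. poly (Y x) (f x))"
proof -
  have "reg (\<lambda>x. \<Sum>k\<le>m. coeff (Y x) k * f x ^ k)" using assms unfolding preg_def by auto
  moreover have "poly (Y x) (f x) = (\<Sum>k\<le>m. coeff (Y x) k * f x ^ k)" if "x \<in> U" for x
    using assms(3)[OF that] by (rule poly_altdef_le)
  ultimately show ?thesis by (subst reg_cong)
qed

end

text \<open>This is applied twice: to the monic representatives on \<open>R_open\<close> and to the
  products of linear factors on \<open>Rt_open\<close>. The bounds \<open>e'\<close> and
  \<open>e''\<close> supply the degree bound that long division needs.\<close>

lemma (in function_algebra) preg_Wr_mod:
  assumes preg: "preg Y" "preg Y'" "preg Y''"
    and Y: "\<And>x. x \<in> U \<Longrightarrow> degree (Y x) = e \<and> lead_coeff (Y x) = 1"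
    and deg: "\<And>x. x \<in> U \<Longrightarrow> degree (Y' x) \<le> e'" "\<And>x. x \<in> U \<Longrightarrow> degree (Y'' x) \<le> e''"
  shows "preg (\<lambda>x. Wr (pderiv (Y x)) (T * Y' x * Y'' x) mod Y x)"
proof (rule preg_mod)
  show "degree (Wr (pderiv (Y x)) (T * Y' x * Y'' x)) \<le> e + (degree T + e' + e'')"
    if x: "x \<in> U" for x
  proof -
    have "degree (T * Y' x * Y'' x) \<le> degree T + e' + e''"
      using degree_mult_le[of "T * Y' x" "Y'' x"] degree_mult_le[of T "Y' x"] deg[OF x] by linarith
    moreover have "degree (pderiv (Y x)) \<le> e" "degree (pderiv (pderiv (Y x))) \<le> e"
      using Y[OF x] by (simp_all add: degree_pderiv)
    moreover have "degree (Wr f g) \<le> a + b"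
      if "degree f \<le> a" "degree (pderiv f) \<le> a" "degree g \<le> b" for f g a b
      unfolding Wr_def
    proof (rule degree_diff_le)
      show "degree (f * pderiv g) \<le> a + b"
        using degree_mult_le[of f "pderiv g"] degree_pderiv[of g] that by linarith
      show "degree (pderiv f * g) \<le> a + b"
        using degree_mult_le[of "pderiv f" g] that by linarith
    qed
    ultimately show ?thesis by blast
  qed
qed (use preg Y in auto)

text \<open>The preimage of an ideal under a ring homomorphism is an ideal. Hence the functions
  whose pullback lies in \<open>J\<close> contain, along with \<open>S\<close>, the whole ideal
  generated by \<open>S\<close>; the other inclusion is monotonicity.\<close>

lemma genideal_pullback:
  assumes "function_algebra U F" and "function_algebra V G"
    and maps: "\<And>t. t \<in> U \<Longrightarrow> \<phi> t \<in> V"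
    and pull: "\<And>f. f \<in> G \<Longrightarrow> (\<lambda>t\<in>U. f (\<phi> t)) \<in> F"
    and S: "S \<subseteq> G"
  shows "Idl\<^bsub>function_ring U F\<^esub> {(\<lambda>t\<in>U. f (\<phi> t)) | f. f \<in> Idl\<^bsub>function_ring V G\<^esub> S}
    = Idl\<^bsub>function_ring U F\<^esub> {(\<lambda>t\<in>U. f (\<phi> t)) | f. f \<in> S}"
proof -
  interpret A: function_algebra U F by fact
  interpret B: function_algebra V G by fact
  define J where "J = Idl\<^bsub>function_ring U F\<^esub> {(\<lambda>t\<in>U. f (\<phi> t)) | f. f \<in> S}"
  have SF: "{(\<lambda>t\<in>U. f (\<phi> t)) | f. f \<in> S} \<subseteq> F" using pull S by blast
  have J: "ideal J (function_ring U F)" unfolding J_def by (rule A.ideal_genideal[OF SF])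
  have "ideal {f \<in> G. (\<lambda>t\<in>U. f (\<phi> t)) \<in> J} (function_ring V G)"
    unfolding B.ideal_function_ring_iff
  proof (intro conjI ballI)
    have "(\<lambda>t\<in>U. (\<lambda>x\<in>V. 0) (\<phi> t)) = (\<lambda>t\<in>U. 0)" using maps by (intro restrict_ext) simp
    moreover have "(\<lambda>t\<in>U. 0) \<in> J" using J unfolding A.ideal_function_ring_iff by blast
    ultimately have "(\<lambda>t\<in>U. (\<lambda>x\<in>V. 0) (\<phi> t)) \<in> J" 
      by (rule ssubst[where P = "\<lambda>h. h \<in> J"])
    then show "(\<lambda>x\<in>V. 0) \<in> {f \<in> G. (\<lambda>t\<in>U. f (\<phi> t)) \<in> J}"
      using B.const_mem by blast
  next
    fix f g assume f: "f \<in> {f \<in> G. (\<lambda>t\<in>U. f (\<phi> t)) \<in> J}" and g: "g \<in> {f \<in> G. (\<lambda>t\<in>U. f (\<phi> t)) \<in> J}"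
    have "(\<lambda>t\<in>U. (\<lambda>t\<in>U. f (\<phi> t)) t + (\<lambda>t\<in>U. g (\<phi> t)) t) \<in> J"
      using f g J unfolding A.ideal_function_ring_iff by blast
    moreover have "(\<lambda>t\<in>U. (\<lambda>t\<in>U. f (\<phi> t)) t + (\<lambda>t\<in>U. g (\<phi> t)) t)
        = (\<lambda>t\<in>U. (\<lambda>x\<in>V. f x + g x) (\<phi> t))"
      using maps by (intro restrict_ext) simp
    ultimately show "(\<lambda>x\<in>V. f x + g x) \<in> {f \<in> G. (\<lambda>t\<in>U. f (\<phi> t)) \<in> J}"
      using f g B.add_mem by simp
  next
    fix f g assume f: "f \<in> {f \<in> G. (\<lambda>t\<in>U. f (\<phi> t)) \<in> J}" and g: "g \<in> G"
    have "(\<lambda>t\<in>U. (\<lambda>t\<in>U. g (\<phi> t)) t * (\<lambda>t\<in>U. f (\<phi> t)) t) \<in> J"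
      using f pull[OF g] J unfolding A.ideal_function_ring_iff by blast
    moreover have "(\<lambda>t\<in>U. (\<lambda>t\<in>U. g (\<phi> t)) t * (\<lambda>t\<in>U. f (\<phi> t)) t)
        = (\<lambda>t\<in>U. (\<lambda>x\<in>V. g x * f x) (\<phi> t))"
      using maps by (intro restrict_ext) simp
    ultimately show "(\<lambda>x\<in>V. g x * f x) \<in> {f \<in> G. (\<lambda>t\<in>U. f (\<phi> t)) \<in> J}"
      using f g B.mult_mem by simp
  qed auto
  moreover have "S \<subseteq> {f \<in> G. (\<lambda>t\<in>U. f (\<phi> t)) \<in> J}"
    using S A.subset_genideal[OF SF] unfolding J_def by blast
  ultimately have sub: "Idl\<^bsub>function_ring V G\<^esub> S \<subseteq> {f \<in> G. (\<lambda>t\<in>U. f (\<phi> t)) \<in> J}"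
    by (rule B.genideal_subset)
  let ?P = "{(\<lambda>t\<in>U. f (\<phi> t)) | f. f \<in> Idl\<^bsub>function_ring V G\<^esub> S}"
  have PJ: "?P \<subseteq> J" using sub by blast
  have PF: "?P \<subseteq> F"
    using PJ J unfolding A.ideal_function_ring_iff by (elim conjE) (rule subset_trans)
  have "{(\<lambda>t\<in>U. f (\<phi> t)) | f. f \<in> S} \<subseteq> ?P" using B.subset_genideal[OF S] by blast
  then have "J \<subseteq> Idl\<^bsub>function_ring U F\<^esub> ?P"
    unfolding J_def using A.subset_genideal[OF PF]
    by (intro A.genideal_subset[OF A.ideal_genideal[OF PF]]) (rule subset_trans)
  then show ?thesis using A.genideal_subset[OF J PJ] unfolding J_def by (rule equalityI[rotated])
qed

section \<open>Regular functions and the map \<open>\<Gamma>\<close>\<close>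

text \<open>With \<open>UNIV\<close> as the domain, the calculus of \<open>reg\<close> and
  \<open>preg\<close> applies to polynomial functions as well; it is used for the coefficients of
  the \<open>y_i\<close> as functions of their roots.\<close>

lemma function_algebra_poly_funs: "function_algebra UNIV (poly_funs I)"
  by unfold_locales (auto simp: restrict_UNIV intro: poly_funs.intros)

lemma poly_funs_subst:
  assumes "p \<in> poly_funs I" and "\<And>v. v \<in> I \<Longrightarrow> (\<lambda>t. c t v) \<in> poly_funs J"
  shows "(\<lambda>t. p (c t)) \<in> poly_funs J"
  using assms by induction (auto intro: poly_funs.intros)

lemma function_algebra_regular_affine: "function_algebra U (regular_affine I U)"
proof
  show "regular_affine I U \<subseteq> extensional U" by (auto simp: regular_affine_def)
  show "(\<lambda>x\<in>U. c) \<in> regular_affine I U" for c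
    unfolding regular_affine_def
    by simp (intro ballI, rule bexI[of _ "\<lambda>_. c"], rule bexI[of _ "\<lambda>_. 1"],
        auto intro: poly_funs.const)
  fix f g assume f: "f \<in> regular_affine I U" and g: "g \<in> regular_affine I U"
  have "\<exists>p\<in>poly_funs I. \<exists>q\<in>poly_funs I. q x \<noteq> 0
        \<and> (\<forall>y\<in>U. q y \<noteq> 0 \<longrightarrow> f y + g y = p y / q y)"
    "\<exists>p\<in>poly_funs I. \<exists>q\<in>poly_funs I. q x \<noteq> 0
        \<and> (\<forall>y\<in>U. q y \<noteq> 0 \<longrightarrow> f y * g y = p y / q y)"
    if x: "x \<in> U" for x
  proof -
    obtain p q where pq: "p \<in> poly_funs I" "q \<in> poly_funs I" "q x \<noteq> 0"
        "\<And>y. y \<in> U \<Longrightarrow> q y \<noteq> 0 \<Longrightarrow> f y = p y / q y"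
      using f x unfolding regular_affine_def by blast
    obtain p' q' where pq': "p' \<in> poly_funs I" "q' \<in> poly_funs I" "q' x \<noteq> 0"
        "\<And>y. y \<in> U \<Longrightarrow> q' y \<noteq> 0 \<Longrightarrow> g y = p' y / q' y"
      using g x unfolding regular_affine_def by blast
    have eqs: "f y + g y = (p y * q' y + p' y * q y) / (q y * q' y)"
        "f y * g y = (p y * p' y) / (q y * q' y)" if "y \<in> U" "q y * q' y \<noteq> 0" for y
      using pq(4)[OF that(1)] pq'(4)[OF that(1)] that(2) by (auto simp: add_frac_eq)
    show "\<exists>p\<in>poly_funs I. \<exists>q\<in>poly_funs I. q x \<noteq> 0
        \<and> (\<forall>y\<in>U. q y \<noteq> 0 \<longrightarrow> f y + g y = p y / q y)"
      by (rule bexI[of _ "\<lambda>y. p y * q' y + p' y * q y"], rule bexI[of _ "\<lambda>y. q y * q' y"])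
        (use eqs(1) pq(1-3) pq'(1-3) in \<open>auto intro: poly_funs.intros\<close>)
    show "\<exists>p\<in>poly_funs I. \<exists>q\<in>poly_funs I. q x \<noteq> 0
        \<and> (\<forall>y\<in>U. q y \<noteq> 0 \<longrightarrow> f y * g y = p y / q y)"
      by (rule bexI[of _ "\<lambda>y. p y * p' y"], rule bexI[of _ "\<lambda>y. q y * q' y"])
        (use eqs(2) pq(1-3) pq'(1-3) in \<open>auto intro: poly_funs.intros\<close>)
  qed
  then show "(\<lambda>x\<in>U. f x + g x) \<in> regular_affine I U" "(\<lambda>x\<in>U. f x * g x) \<in> regular_affine I U"
    by (simp_all add: regular_affine_def)
qed

lemma regular_affine_if_poly_funs:
  assumes "p \<in> poly_funs I" shows "(\<lambda>x\<in>U. p x) \<in> regular_affine I U"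
  using assms unfolding regular_affine_def
  by simp (intro ballI, rule bexI[of _ p], rule bexI[of _ "\<lambda>_. 1"], auto intro: poly_funs.const)

text \<open>The source of all units: a regular function without zeros on \<open>U\<close> is
  invertible in the coordinate ring.\<close>

lemma regular_affine_inverse:
  assumes f: "restrict f U \<in> regular_affine I U" and nz: "\<And>x. x \<in> U \<Longrightarrow> f x \<noteq> 0"
  shows "(\<lambda>x\<in>U. inverse (f x)) \<in> regular_affine I U"
proof -
  have "\<exists>p\<in>poly_funs I. \<exists>q\<in>poly_funs I. q x \<noteq> 0
        \<and> (\<forall>y\<in>U. q y \<noteq> 0 \<longrightarrow> inverse (f y) = p y / q y)"
    if x: "x \<in> U" for x
  proof -
    have "\<exists>p\<in>poly_funs I. \<exists>q\<in>poly_funs I. q x \<noteq> 0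
        \<and> (\<forall>y\<in>U. q y \<noteq> 0 \<longrightarrow> restrict f U y = p y / q y)"
      using f x unfolding regular_affine_def by blast
    then obtain p q where pq: "p \<in> poly_funs I" "q \<in> poly_funs I" "q x \<noteq> 0"
        "\<And>y. y \<in> U \<Longrightarrow> q y \<noteq> 0 \<Longrightarrow> f y = p y / q y"
      by force
    have "p x \<noteq> 0" using pq x nz[OF x] by auto
    \<comment> \<open>the denominator \<open>p q\<close> rather than \<open>p\<close> excludes the points where \<open>f = p / q\<close> fails\<close>
    moreover have "inverse (f y) = (q y * q y) / (p y * q y)" if "y \<in> U" "p y * q y \<noteq> 0" for y
      using pq(4)[OF that(1)] that(2) by auto
    moreover have num: "(\<lambda>y. q y * q y) \<in> poly_funs I"
      and den: "(\<lambda>y. p y * q y) \<in> poly_funs I"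
      using pq(1,2) poly_funs.mult by blast+
    ultimately have "p x * q x \<noteq> 0
        \<and> (\<forall>y\<in>U. p y * q y \<noteq> 0 \<longrightarrow> inverse (f y) = (q y * q y) / (p y * q y))"
      using pq(3) by simp
    then show ?thesis by (rule bexI[OF bexI[OF _ den] num])
  qed
  then show ?thesis by (simp add: regular_affine_def)
qed

section \<open>Fractions of multihomogeneous polynomials\<close>

lemma multihom_polys_mult:
  "p \<in> multihom_polys N l e \<Longrightarrow> q \<in> multihom_polys N l e'
    \<Longrightarrow> (\<lambda>c. p c * q c) \<in> multihom_polys N l (\<lambda>i. e i + e' i)"
  by (auto simp: multihom_polys_def power_add prod.distrib intro: poly_funs.mult)

lemma multihom_polys_add:
  "p \<in> multihom_polys N l e \<Longrightarrow> q \<in> multihom_polys N l e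
    \<Longrightarrow> (\<lambda>c. p c + q c) \<in> multihom_polys N l e"
  by (auto simp: multihom_polys_def algebra_simps intro: poly_funs.add)

lemma regular_R_frac:
  assumes "f \<in> regular_R N l U"
  shows "\<forall>\<eta>\<in>U. \<exists>e. \<exists>p\<in>multihom_polys N l e. \<exists>q\<in>multihom_polys N l e.
        (\<forall>c\<in>hom_coords N \<eta>. q c \<noteq> 0) \<and>
        (\<forall>\<theta>\<in>U. \<forall>c\<in>hom_coords N \<theta>. q c \<noteq> 0 \<longrightarrow> f \<theta> = p c / q c)"
  using assms unfolding regular_R_def mem_Collect_eq by (rule conjunct2)

text \<open>Over the common denominator \<open>q * q'\<close> the numerators \<open>p * q'\<close>,
  \<open>q * p'\<close> and \<open>p * p'\<close> all have multidegree \<open>e + e'\<close>, so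
  sums and products are again fractions of equal multidegree.\<close>

lemma function_algebra_regular_R: "function_algebra U (regular_R N l U)"
proof
  show "regular_R N l U \<subseteq> extensional U" by (auto simp: regular_R_def)
  have const: "(\<lambda>_. c) \<in> multihom_polys N l (\<lambda>_. 0)" for c
    by (simp add: multihom_polys_def poly_funs.const)
  show "(\<lambda>x\<in>U. c) \<in> regular_R N l U" for c
  proof -
    have "\<exists>e. \<exists>p\<in>multihom_polys N l e. \<exists>q\<in>multihom_polys N l e.
        (\<forall>b\<in>hom_coords N \<eta>. q b \<noteq> 0) \<and>
        (\<forall>\<theta>\<in>U. \<forall>b\<in>hom_coords N \<theta>. q b \<noteq> 0 \<longrightarrow> c = p b / q b)" for \<eta>
      by (rule exI[of _ "\<lambda>_. 0"], rule bexI[OF _ const[of c]], rule bexI[OF _ const[of 1]]) simp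
    then show ?thesis unfolding regular_R_def by auto
  qed
  fix f g assume f: "f \<in> regular_R N l U" and g: "g \<in> regular_R N l U"
  note reg_f = regular_R_frac[OF f] and reg_g = regular_R_frac[OF g]
  have "\<exists>e. \<exists>p\<in>multihom_polys N l e. \<exists>q\<in>multihom_polys N l e.
        (\<forall>c\<in>hom_coords N \<eta>. q c \<noteq> 0) \<and>
        (\<forall>\<theta>\<in>U. \<forall>c\<in>hom_coords N \<theta>. q c \<noteq> 0 \<longrightarrow> f \<theta> + g \<theta> = p c / q c)"
    "\<exists>e. \<exists>p\<in>multihom_polys N l e. \<exists>q\<in>multihom_polys N l e.
        (\<forall>c\<in>hom_coords N \<eta>. q c \<noteq> 0) \<and>
        (\<forall>\<theta>\<in>U. \<forall>c\<in>hom_coords N \<theta>. q c \<noteq> 0 \<longrightarrow> f \<theta> * g \<theta> = p c / q c)"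
    if \<eta>: "\<eta> \<in> U" for \<eta>
  proof -
    obtain e p q where pq: "p \<in> multihom_polys N l e" "q \<in> multihom_polys N l e"
        "\<forall>c\<in>hom_coords N \<eta>. q c \<noteq> 0"
        "\<forall>\<theta>\<in>U. \<forall>c\<in>hom_coords N \<theta>. q c \<noteq> 0 \<longrightarrow> f \<theta> = p c / q c"
      using bspec[OF reg_f \<eta>] by (elim exE bexE conjE) (rule that)
    obtain e' p' q' where pq': "p' \<in> multihom_polys N l e'" "q' \<in> multihom_polys N l e'"
        "\<forall>c\<in>hom_coords N \<eta>. q' c \<noteq> 0"
        "\<forall>\<theta>\<in>U. \<forall>c\<in>hom_coords N \<theta>. q' c \<noteq> 0 \<longrightarrow> g \<theta> = p' c / q' c"
      using bspec[OF reg_g \<eta>] by (elim exE bexE conjE) (rule that)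
    let ?e = "\<lambda>i. e i + e' i"
    note q = multihom_polys_mult[OF pq(2) pq'(2)]
      and p = multihom_polys_mult[OF pq(1) pq'(1)]
      and s = multihom_polys_add[OF multihom_polys_mult[OF pq(1) pq'(2)]
          multihom_polys_mult[OF pq(2) pq'(1)]]
    have eqs: "f \<theta> + g \<theta> = (p c * q' c + q c * p' c) / (q c * q' c)"
        "f \<theta> * g \<theta> = (p c * p' c) / (q c * q' c)"
      if "\<theta> \<in> U" "c \<in> hom_coords N \<theta>" "q c * q' c \<noteq> 0" for \<theta> c
    proof -
      have "f \<theta> = p c / q c" "g \<theta> = p' c / q' c" using pq(4) pq'(4) that by auto
      then show "f \<theta> + g \<theta> = (p c * q' c + q c * p' c) / (q c * q' c)"
        "f \<theta> * g \<theta> = (p c * p' c) / (q c * q' c)"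
        using that(3) by (simp_all add: add_frac_eq)
    qed
    show "\<exists>e. \<exists>p\<in>multihom_polys N l e. \<exists>q\<in>multihom_polys N l e.
        (\<forall>c\<in>hom_coords N \<eta>. q c \<noteq> 0) \<and>
        (\<forall>\<theta>\<in>U. \<forall>c\<in>hom_coords N \<theta>. q c \<noteq> 0 \<longrightarrow> f \<theta> + g \<theta> = p c / q c)"
      by (rule exI[of _ ?e], rule bexI[OF _ s], rule bexI[OF _ q])
        (use eqs(1) pq(3) pq'(3) in \<open>auto\<close>)
    show "\<exists>e. \<exists>p\<in>multihom_polys N l e. \<exists>q\<in>multihom_polys N l e.
        (\<forall>c\<in>hom_coords N \<eta>. q c \<noteq> 0) \<and>
        (\<forall>\<theta>\<in>U. \<forall>c\<in>hom_coords N \<theta>. q c \<noteq> 0 \<longrightarrow> f \<theta> * g \<theta> = p c / q c)"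
      by (rule exI[of _ ?e], rule bexI[OF _ p], rule bexI[OF _ q])
        (use eqs(2) pq(3) pq'(3) in \<open>auto\<close>)
  qed
  then show "(\<lambda>x\<in>U. f x + g x) \<in> regular_R N l U" "(\<lambda>x\<in>U. f x * g x) \<in> regular_R N l U"
    by (simp_all add: regular_R_def)
qed

section \<open>Monic representatives and their coefficients\<close>

lemma monic_rep_eq:
  assumes "i \<in> {1..N}" "\<eta> i = line p" "p \<noteq> 0"
  shows "monic_rep N \<eta> i = smult (inverse (lead_coeff p)) p"
proof -
  have "(THE q. q \<in> \<eta> i \<and> lead_coeff q = 1) = smult (inverse (lead_coeff p)) p"
  proof (rule the_equality)
    show "smult (inverse (lead_coeff p)) p \<in> \<eta> i
        \<and> lead_coeff (smult (inverse (lead_coeff p)) p) = 1"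
      using assms by (auto simp: line_def)
  next
    fix q assume q: "q \<in> \<eta> i \<and> lead_coeff q = 1"
    then obtain c where "q = smult c p" using assms by (auto simp: line_def)
    then show "q = smult (inverse (lead_coeff p)) p"
      using q assms(3) inverse_unique[of "lead_coeff p" c]
      by (metis lead_coeff_smult mult.commute)
  qed
  then show ?thesis using assms(1) by (simp add: monic_rep_def)
qed

lemma lead_coeff_monic_rep:
  assumes "\<eta> \<in> R_space N l" shows "lead_coeff (monic_rep N \<eta> i) = 1"
proof (cases "i \<in> {1..N}")
  case True
  then have "\<eta> i \<in> projectivization (polys_upto (l i))"
    using assms unfolding R_space_def by blast
  then obtain p where "\<eta> i = line p" "p \<noteq> 0" by (auto simp: projectivization_def)
  then show ?thesis using monic_rep_eq[OF True] by simp
next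
  case False
  then show ?thesis by (auto simp: monic_rep_def)
qed

lemma line_eq_line:
  assumes "q \<in> line p" "q \<noteq> 0" shows "line q = line p"
proof -
  obtain c where c: "q = smult c p" "c \<noteq> 0" using assms by (auto simp: line_def)
  then have "smult b p = smult (b / c) q" for b by simp
  then show ?thesis unfolding line_def c(1) by fastforce
qed

text \<open>The monic representative is obtained from homogeneous coordinates by dividing by the leading
  one, so its coefficients have multidegree \<open>0\<close>.\<close>

lemma regular_R_coeff_monic_rep:
  assumes U: "U \<subseteq> R_space N l"
    and deg: "\<And>\<eta>. \<eta> \<in> U \<Longrightarrow> int (degree (monic_rep N \<eta> i)) = l i" and i: "i \<in> {1..N}"
  shows "(\<lambda>\<eta>\<in>U. coeff (monic_rep N \<eta> i) k) \<in> regular_R N l U"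
proof (cases "int k \<le> l i")
  \<comment> \<open>Beyond the degree there is no homogeneous coordinate with index
    \<open>k\<close>, but there the coefficient is identically zero.\<close>
  case False
  then have "(\<lambda>\<eta>\<in>U. coeff (monic_rep N \<eta> i) k) = (\<lambda>\<eta>\<in>U. 0)"
    using deg by (intro restrict_ext coeff_eq_0) force
  then show ?thesis using function_algebra.const_mem[OF function_algebra_regular_R] by metis
next
  case True
  \<comment> \<open>The coordinates \<open>c (i, m)\<close> are linear in the \<open>i\<close>-th
    factor and constant in the others, so their multidegree is the \<open>i\<close>-th unit
    vector.\<close>
  define e :: "nat \<Rightarrow> nat" where "e = (\<lambda>j. if j = i then 1 else 0)"
  have mh: "(\<lambda>c. c (i, m)) \<in> multihom_polys N l e" if "int m \<le> l i" for m
  proof -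
    have "(\<Prod>j=1..N. \<mu> j ^ e j) = \<mu> i" for \<mu> :: "nat \<Rightarrow> complex"
    proof -
      have "(\<Prod>j=1..N. \<mu> j ^ e j) = (\<Prod>j=1..N. if j = i then \<mu> j else 1)"
        by (rule prod.cong) (auto simp: e_def)
      then show ?thesis using i by simp
    qed
    then show ?thesis using that i
      by (auto simp: multihom_polys_def R_index_def intro: poly_funs.coord)
  qed
  \<comment> \<open>As the degree equals \<open>l i\<close> throughout \<open>U\<close>, the
    coordinate at \<open>nat (l i)\<close> is the leading coefficient of every spanning vector and
    never vanishes. A single fraction thus represents the coefficient on all of
    \<open>U\<close>.\<close>
  have coords: "c (i, nat (l i)) \<noteq> 0 \<and> coeff (monic_rep N \<eta> i) k = c (i, k) / c (i, nat (l i))"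
    if \<eta>: "\<eta> \<in> U" and c: "c \<in> hom_coords N \<eta>" for \<eta> c
  proof -
    obtain y where y: "y i \<in> \<eta> i" "y i \<noteq> 0" "c = (\<lambda>(i, k). coeff (y i) k)"
      using c i unfolding hom_coords_def by blast
    have "\<eta> i \<in> projectivization (polys_upto (l i))"
      using U \<eta> i unfolding R_space_def by blast
    then obtain p where "\<eta> i = line p" by (auto simp: projectivization_def)
    then have "\<eta> i = line (y i)" using line_eq_line y by metis
    then have m: "monic_rep N \<eta> i = smult (inverse (lead_coeff (y i))) (y i)"
      using monic_rep_eq i y by blast
    then have "nat (l i) = degree (y i)" using deg[OF \<eta>] y(2) by simp
    then show ?thesis using m y by (simp add: field_simps)
  qed
  have *: "(\<lambda>c. c (i, nat (l i))) \<in> multihom_polys N l e" using True by (intro mh) simp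
  have "\<exists>e. \<exists>p\<in>multihom_polys N l e. \<exists>q\<in>multihom_polys N l e.
      (\<forall>c\<in>hom_coords N \<eta>. q c \<noteq> 0) \<and>
      (\<forall>\<theta>\<in>U. \<forall>c\<in>hom_coords N \<theta>. q c \<noteq> 0 \<longrightarrow> coeff (monic_rep N \<theta> i) k = p c / q c)"
    if \<eta>: "\<eta> \<in> U" for \<eta>
  proof (rule exI[of _ e], rule bexI[OF _ mh[OF True]], rule bexI[OF _ *], intro conjI ballI impI)
    show "c (i, nat (l i)) \<noteq> 0" if "c \<in> hom_coords N \<eta>" for c
      using coords[OF \<eta> that] ..
    show "coeff (monic_rep N \<theta> i) k = c (i, k) / c (i, nat (l i))"
      if "\<theta> \<in> U" "c \<in> hom_coords N \<theta>" for \<theta> c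
      using coords[OF that] ..
  qed
  then show ?thesis by (simp add: regular_R_def)
qed

text \<open>The monic representatives of the point \<open>Gamma_map N l t\<close>; the value 1
  outside \<open>{1..N}\<close> realizes the convention \<open>y_0 = y_(N+1) = 1\<close>.\<close>

definition y_poly :: "nat \<Rightarrow> (nat \<Rightarrow> int) \<Rightarrow> (nat \<times> nat \<Rightarrow> complex) \<Rightarrow> nat \<Rightarrow> complex poly" where
  "y_poly N l t i = (if i \<in> {1..N} then \<Prod>j\<in>{1..nat (l i)}. [:- t (i, j), 1:] else 1)"

lemma lead_coeff_y_poly [simp]: "lead_coeff (y_poly N l t i) = 1"
  by (simp add: y_poly_def lead_coeff_prod)

lemma degree_y_poly: "i \<in> {1..N} \<Longrightarrow> degree (y_poly N l t i) = nat (l i)"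
  by (simp add: y_poly_def degree_prod_eq_sum_degree)

lemma y_poly_nonzero [simp]: "y_poly N l t i \<noteq> 0"
  using lead_coeff_y_poly by (metis leading_coeff_0_iff zero_neq_one)

lemma poly_y_poly_eq_0_iff:
  "poly (y_poly N l t i) x = 0 \<longleftrightarrow> i \<in> {1..N} \<and> x \<in> (\<lambda>j. t (i, j)) ` {1..nat (l i)}"
  by (auto simp: y_poly_def poly_prod)

lemma Gamma_map_eq: "i \<in> {1..N} \<Longrightarrow> Gamma_map N l t i = line (y_poly N l t i)"
  by (simp add: Gamma_map_def y_poly_def)

lemma monic_rep_Gamma_map: "monic_rep N (Gamma_map N l t) = y_poly N l t"
proof
  fix i show "monic_rep N (Gamma_map N l t) i = y_poly N l t i"
  proof (cases "i \<in> {1..N}")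
    case True
    then show ?thesis using monic_rep_eq[of i N "Gamma_map N l t" "y_poly N l t i"]
      by (simp add: Gamma_map_eq)
  next
    case False
    then show ?thesis by (auto simp: monic_rep_def y_poly_def)
  qed
qed

text \<open>The order of \<open>x\<close> as a root is the number of indices \<open>j\<close> with
  \<open>f j = x\<close>, so orders at most 1 mean that all fibres of \<open>f\<close> on
  \<open>J\<close> have at most one element.\<close>

lemma rsquarefree_prod_linear_iff:
  fixes f :: "'a \<Rightarrow> 'b::field"
  assumes "finite J"
  shows "rsquarefree (\<Prod>j\<in>J. [:- f j, 1:]) \<longleftrightarrow> inj_on f J"
proof -
  have nz: "(\<Prod>j\<in>J. [:- f j, 1:]) \<noteq> 0" using assms by simp
  have order: "order x (\<Prod>j\<in>J. [:- f j, 1:]) = card {j \<in> J. f j = x}" for x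
    using assms
  proof (induction J rule: finite_induct)
    case (insert j J)
    then have "order x (\<Prod>j\<in>insert j J. [:- f j, 1:])
        = order x [:- f j, 1:] + card {j \<in> J. f j = x}"
      by (simp add: order_mult del: mult_pCons_left)
    moreover have "order x [:- f j, 1:] = (if f j = x then 1 else 0)"
      using order_power_n_n[of x 1] by (auto intro: order_0I)
    moreover have "{k \<in> insert j J. f k = x}
        = (if f j = x then insert j {k \<in> J. f k = x} else {k \<in> J. f k = x})" by auto
    ultimately show ?case using insert by auto
  qed (simp add: order_0I)
  have "(card A = 0 \<or> card A = 1) \<longleftrightarrow> (\<forall>j\<in>A. \<forall>k\<in>A. j = k)" if "finite A" for A :: "'a set"
    using card_le_Suc0_iff_eq[OF that] by auto
  from this[of "{j \<in> J. f j = x}" for x]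
  have "(card {j \<in> J. f j = x} = 0 \<or> card {j \<in> J. f j = x} = 1)
      \<longleftrightarrow> (\<forall>j\<in>{j \<in> J. f j = x}. \<forall>k\<in>{j \<in> J. f j = x}. j = k)" for x
    using assms by simp
  then show ?thesis unfolding rsquarefree_def order inj_on_def using nz by blast
qed

text \<open>Thus the open set underlying the scheme-theoretic preimage is the one on which the
  critical points of the master function are considered, and only ideals remain to be
  compared.\<close>

lemma Gamma_map_in_R_open_iff:
  assumes t: "t \<in> Rt_space N l"
  shows "Gamma_map N l t \<in> R_open N l Z \<longleftrightarrow> t \<in> Rt_open N l Z"
proof -
  \<comment> \<open>\<open>Rt_space\<close> has a point only if every \<open>l i\<close> is
    nonnegative, so the passage from \<open>l i\<close> to \<open>nat (l i)\<close> loses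
    nothing.\<close>
  have l: "l i \<ge> 0" if "i \<in> {1..N}" for i
    using t that unfolding Rt_space_def by (metis emptyE)
  have "Gamma_map N l t i \<in> projectivization (polys_upto (l i))" if i: "i \<in> {1..N}" for i
    unfolding Gamma_map_eq[OF i] projectivization_def polys_upto_def
    using degree_y_poly[OF i] l[OF i] by (intro imageI) auto
  then have space: "Gamma_map N l t \<in> R_space N l" by (auto simp: R_space_def Gamma_map_def)
  have "rsquarefree (y_poly N l t i) \<longleftrightarrow> inj_on (\<lambda>j. t (i, j)) {1..nat (l i)}"
    if "i \<in> {1..N}" for i
    using that by (simp add: y_poly_def rsquarefree_prod_linear_iff)
  \<comment> \<open>For \<open>i = N\<close> the neighbour is \<open>y_(N+1) = 1\<close>, which has
    no roots; this matches the restriction to \<open>i < N\<close>.\<close>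
  moreover have "(\<not> (\<exists>x. poly (y_poly N l t i) x = 0 \<and> poly (y_poly N l t (i + 1)) x = 0)) \<longleftrightarrow>
      (i < N \<longrightarrow> (\<lambda>j. t (i, j)) ` {1..nat (l i)} \<inter> (\<lambda>k. t (i + 1, k)) ` {1..nat (l (i + 1))} = {})"
    if "i \<in> {1..N}" for i
    using that unfolding poly_y_poly_eq_0_iff by auto
  moreover have "(\<forall>x\<in>Z. poly (y_poly N l t i) x \<noteq> 0) \<longleftrightarrow> (\<lambda>j. t (i, j)) ` {1..nat (l i)} \<inter> Z = {}"
    if "i \<in> {1..N}" for i
    using that unfolding poly_y_poly_eq_0_iff by blast
  moreover have "int (degree (y_poly N l t i)) = l i" if "i \<in> {1..N}" for i
    using that l by (simp add: degree_y_poly)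
  ultimately have conds: "(int (degree (y_poly N l t i)) = l i
        \<and> (\<forall>x\<in>Z. poly (y_poly N l t i) x \<noteq> 0)
        \<and> \<not> (\<exists>x. poly (y_poly N l t i) x = 0 \<and> poly (y_poly N l t (i + 1)) x = 0)
        \<and> rsquarefree (y_poly N l t i))
      \<longleftrightarrow> (inj_on (\<lambda>j. t (i, j)) {1..nat (l i)}
        \<and> (i < N \<longrightarrow>
             (\<lambda>j. t (i, j)) ` {1..nat (l i)} \<inter> (\<lambda>k. t (i + 1, k)) ` {1..nat (l (i + 1))} = {})
        \<and> (\<lambda>j. t (i, j)) ` {1..nat (l i)} \<inter> Z = {})" if "i \<in> {1..N}" for i
    using that by (simp only: simp_thms conj_ac)
  show ?thesis
    unfolding R_open_def Rt_open_def mem_Collect_eq monic_rep_Gamma_map Let_def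
    using t space by (simp only: conds cong: ball_cong)
qed

text \<open>For \<open>i\<close> in \<open>{1..N}\<close> these are, up to sign, the elementary
  symmetric functions of the roots; the calculus of \<open>preg\<close> avoids writing them
  out.\<close>

lemma poly_funs_coeff_y_poly: "(\<lambda>t. coeff (y_poly N l t i) k) \<in> poly_funs (Rt_index N l)"
proof -
  interpret function_algebra UNIV "poly_funs (Rt_index N l)" by (rule function_algebra_poly_funs)
  have "reg (\<lambda>t. t (i, j))" if "i \<in> {1..N}" "j \<in> {1..nat (l i)}" for j
  proof -
    have "(i, j) \<in> Rt_index N l" using that by (auto simp: Rt_index_def)
    then show ?thesis by (simp add: reg_def restrict_UNIV poly_funs.coord)
  qed
  then have "preg (\<lambda>t. y_poly N l t i)"
    by (cases "i \<in> {1..N}") (auto simp: y_poly_def simp del: One_nat_def)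
  then show ?thesis by (simp add: preg_def reg_def restrict_UNIV)
qed

text \<open>The map lifts to homogeneous coordinates: the coefficients of the \<open>y_i\<close> are
  polynomials in \<open>t\<close> and form a coordinate vector of the image point. Substituting them
  turns multihomogeneous fractions into fractions of polynomials in \<open>t\<close>.\<close>

lemma regular_affine_pullback:
  assumes f: "f \<in> regular_R N l V" and U: "\<And>t. t \<in> U \<Longrightarrow> Gamma_map N l t \<in> V"
  shows "(\<lambda>t\<in>U. f (Gamma_map N l t)) \<in> regular_affine (Rt_index N l) U"
proof -
  define c where "c = (\<lambda>t (i, k). coeff (y_poly N l t i) k)"
  have hom: "c t \<in> hom_coords N (Gamma_map N l t)" for t
  proof -
    have "y_poly N l t i \<in> line (y_poly N l t i)" for i
      by (auto simp: line_def intro!: exI[of _ 1])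
    then show ?thesis
      unfolding hom_coords_def c_def
      by (auto intro!: exI[of _ "y_poly N l t"] simp: Gamma_map_eq simp del: One_nat_def)
  qed
  have subst: "(\<lambda>t. p (c t)) \<in> poly_funs (Rt_index N l)" if "p \<in> multihom_polys N l e" for p e
  proof (rule poly_funs_subst[where p = p and c = c and I = "R_index N l"])
    show "p \<in> poly_funs (R_index N l)" using that by (simp add: multihom_polys_def)
    show "(\<lambda>t. c t v) \<in> poly_funs (Rt_index N l)" for v
      by (cases v) (simp add: c_def poly_funs_coeff_y_poly)
  qed
  have "\<exists>p\<in>poly_funs (Rt_index N l). \<exists>q\<in>poly_funs (Rt_index N l). q t \<noteq> 0
        \<and> (\<forall>s\<in>U. q s \<noteq> 0 \<longrightarrow> f (Gamma_map N l s) = p s / q s)" if t: "t \<in> U" for t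
  proof -
    obtain e p q where pq: "p \<in> multihom_polys N l e" "q \<in> multihom_polys N l e"
        "\<forall>c\<in>hom_coords N (Gamma_map N l t). q c \<noteq> 0"
        "\<forall>\<theta>\<in>V. \<forall>c\<in>hom_coords N \<theta>. q c \<noteq> 0 \<longrightarrow> f \<theta> = p c / q c"
      using bspec[OF regular_R_frac[OF f] U[OF t]]
      by (elim exE bexE conjE) (rule that)
    have "f (Gamma_map N l s) = p (c s) / q (c s)" if "s \<in> U" "q (c s) \<noteq> 0" for s
      using pq(4) U[OF that(1)] that(2) hom by blast
    moreover have "q (c t) \<noteq> 0" using hom pq(3) by blast
    ultimately have "q (c t) \<noteq> 0
        \<and> (\<forall>s\<in>U. q (c s) \<noteq> 0 \<longrightarrow> f (Gamma_map N l s) = p (c s) / q (c s))" by blast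
    then show ?thesis by (rule bexI[OF bexI[OF _ subst[OF pq(2)]] subst[OF pq(1)]])
  qed
  then show ?thesis by (simp add: regular_affine_def)
qed

section \<open>Logarithmic derivatives of the master function\<close>

text \<open>The relation \<open>f' = f * D\<close> is used in place of a quotient, so that the rules
  for products need no nonvanishing condition; only the rule for inverses has one.\<close>

definition has_log_deriv :: "(complex \<Rightarrow> complex) \<Rightarrow> complex \<Rightarrow> complex \<Rightarrow> bool" where
  "has_log_deriv f D x \<longleftrightarrow> (f has_field_derivative f x * D) (at x)"

lemma has_log_deriv_const: "has_log_deriv (\<lambda>_. c) 0 x"
  by (simp add: has_log_deriv_def)

lemma has_log_deriv_mult:
  assumes "has_log_deriv f D x" "has_log_deriv g E x"
  shows "has_log_deriv (\<lambda>u. f u * g u) (D + E) x"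
  unfolding has_log_deriv_def
  by (rule DERIV_cong[OF DERIV_mult[OF assms[unfolded has_log_deriv_def]]]) (simp add: algebra_simps)

lemma has_log_deriv_prod:
  assumes "\<And>j. j \<in> J \<Longrightarrow> has_log_deriv (f j) (D j) x"
  shows "has_log_deriv (\<lambda>u. \<Prod>j\<in>J. f j u) (\<Sum>j\<in>J. D j) x"
  using assms
  by (induction J rule: infinite_finite_induct) (auto intro: has_log_deriv_const has_log_deriv_mult)

lemma has_log_deriv_inverse:
  assumes "has_log_deriv f D x" "f x \<noteq> 0"
  shows "has_log_deriv (\<lambda>u. inverse (f u)) (- D) x"
  unfolding has_log_deriv_def
  by (rule DERIV_cong[OF DERIV_inverse'[OF assms(1)[unfolded has_log_deriv_def] assms(2)]])
    (use assms(2) in simp)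

lemma has_log_deriv_power2:
  assumes "has_log_deriv f D x" shows "has_log_deriv (\<lambda>u. (f u)\<^sup>2) (2 * D) x"
  using has_log_deriv_mult[OF assms assms] by (simp add: power2_eq_square)

lemma has_log_derivI:
  assumes "(f has_field_derivative D) (at x)" "f x \<noteq> 0"
  shows "has_log_deriv f (D / f x) x"
  using assms by (simp add: has_log_deriv_def)

section \<open>Products of linear factors and interpolation\<close>

lemma poly_pderiv_prod_linear:
  fixes c :: "'a \<Rightarrow> 'b::field"
  assumes "finite J" "\<And>j. j \<in> J \<Longrightarrow> x \<noteq> c j"
  shows "poly (pderiv (\<Prod>j\<in>J. [:- c j, 1:])) x
    = poly (\<Prod>j\<in>J. [:- c j, 1:]) x * (\<Sum>j\<in>J. 1 / (x - c j))"
  using assms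
proof (induction J rule: finite_induct)
  case (insert j J)
  then have nz: "x - c j \<noteq> 0" and IH: "poly (pderiv (\<Prod>j\<in>J. [:- c j, 1:])) x
      = poly (\<Prod>j\<in>J. [:- c j, 1:]) x * (\<Sum>j\<in>J. 1 / (x - c j))" by auto
  have "pderiv [:- c j, 1:] = 1" by (simp add: pderiv_pCons)
  then have "poly (pderiv (\<Prod>j\<in>insert j J. [:- c j, 1:])) x
      = (x - c j) * poly (pderiv (\<Prod>j\<in>J. [:- c j, 1:])) x + poly (\<Prod>j\<in>J. [:- c j, 1:]) x"
    using insert.hyps by (simp add: pderiv_mult algebra_simps del: mult_pCons_left mult_pCons_right)
  then show ?case
    unfolding IH using insert.hyps nz
    by (simp add: algebra_simps del: mult_pCons_left mult_pCons_right) (simp add: field_simps)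
qed simp

text \<open>Split off the factor of \<open>c b\<close> and call the rest \<open>g\<close>. At
  \<open>c b\<close> one gets \<open>y' = g\<close> and \<open>y'' = 2 g'\<close>, whence the factor
  2, which later matches the square in the master function.\<close>

lemma poly_pderiv_prod_linear_root:
  fixes c :: "'a \<Rightarrow> 'b::field"
  assumes J: "finite J" "b \<in> J" "inj_on c J"
  defines "y \<equiv> \<Prod>j\<in>J. [:- c j, 1:]"
  shows "poly (pderiv y) (c b) \<noteq> 0"
    and "poly (pderiv y) (c b) = poly (\<Prod>j\<in>J - {b}. [:- c j, 1:]) (c b)"
    and "poly (pderiv (pderiv y)) (c b)
      = poly (pderiv y) (c b) * (\<Sum>j\<in>J - {b}. 2 / (c b - c j))"
proof -
  define g where "g = (\<Prod>j\<in>J - {b}. [:- c j, 1:])"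
  have y: "y = [:- c b, 1:] * g"
    unfolding y_def g_def using J by (simp add: prod.remove del: mult_pCons_left)
  have lin: "pderiv [:- c b, 1:] = 1" by (simp add: pderiv_pCons)
  have y': "pderiv y = [:- c b, 1:] * pderiv g + g"
    unfolding y pderiv_mult lin by (simp del: mult_pCons_left mult_pCons_right)
  have y'': "pderiv (pderiv y) = [:- c b, 1:] * pderiv (pderiv g) + 2 * pderiv g"
    unfolding y' pderiv_mult pderiv_add lin by (simp del: mult_pCons_left mult_pCons_right)
  have ne: "c b \<noteq> c j" if "j \<in> J - {b}" for j
    using J that by (auto dest: inj_onD)
  have g: "poly g (c b) \<noteq> 0"
    unfolding g_def using J ne by (auto simp: poly_prod)
  show y'b: "poly (pderiv y) (c b) = poly (\<Prod>j\<in>J - {b}. [:- c j, 1:]) (c b)"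
    unfolding g_def[symmetric] y' by simp
  then show "poly (pderiv y) (c b) \<noteq> 0" using g by (simp add: g_def)
  have "poly (pderiv (pderiv y)) (c b) = 2 * poly (pderiv g) (c b)" unfolding y'' by simp
  also have "poly (pderiv g) (c b) = poly g (c b) * (\<Sum>j\<in>J - {b}. 1 / (c b - c j))"
    unfolding g_def using J ne by (intro poly_pderiv_prod_linear) auto
  finally show "poly (pderiv (pderiv y)) (c b)
      = poly (pderiv y) (c b) * (\<Sum>j\<in>J - {b}. 2 / (c b - c j))"
    unfolding y'b g_def[symmetric] by (simp add: sum_distrib_left mult.commute)
qed

text \<open>The derivative of \<open>y\<close> at \<open>c j\<close> is the usual Lagrange
  denominator, the product of the differences \<open>c j - c k\<close>. Both sides have degree below
  \<open>card J\<close> and agree at the \<open>card J\<close> distinct nodes. Allowing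
  \<open>p = 0\<close> covers empty \<open>J\<close>.\<close>

lemma lagrange_interpolation:
  fixes c :: "'a \<Rightarrow> 'b::field"
  assumes J: "finite J" "inj_on c J" and p: "p = 0 \<or> degree p < card J"
  defines "y \<equiv> \<Prod>j\<in>J. [:- c j, 1:]"
  shows "p = (\<Sum>j\<in>J. smult (poly p (c j) * inverse (poly (pderiv y) (c j)))
    (\<Prod>k\<in>J - {j}. [:- c k, 1:]))" (is "p = ?q")
proof (cases "p = 0")
  case False
  with p have p: "degree p < card J" by simp
  show ?thesis
  proof (rule poly_eqI_degree)
    show "card (c ` J) > degree p" using p J by (simp add: card_image)
    have "degree ?q \<le> card J - 1"
    proof (rule degree_sum_le)
      fix j assume "j \<in> J"
      have "degree (\<Prod>k\<in>J - {j}. [:- c k, 1:]) \<le> card (J - {j})"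
        using degree_prod_sum_le[of "J - {j}" "\<lambda>k. [:- c k, 1:]"] J by simp
      then show "degree (smult (poly p (c j) * inverse (poly (pderiv y) (c j)))
          (\<Prod>k\<in>J - {j}. [:- c k, 1:])) \<le> card J - 1"
        using degree_smult_le order_trans J \<open>j \<in> J\<close> by (metis card_Diff_singleton)
    qed (use J in simp)
    then show "card (c ` J) > degree ?q" using p J by (simp add: card_image)
    fix x assume "x \<in> c ` J"
    then obtain b where b: "b \<in> J" "x = c b" by blast
    have other: "poly (smult (poly p (c j) * inverse (poly (pderiv y) (c j)))
        (\<Prod>k\<in>J - {j}. [:- c k, 1:])) (c b) = 0" if "j \<in> J - {b}" for j
      using b(1) J that by (auto simp: poly_prod)
    have "poly ?q (c b) = poly (smult (poly p (c b) * inverse (poly (pderiv y) (c b)))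
        (\<Prod>k\<in>J - {b}. [:- c k, 1:])) (c b)"
      unfolding sum.remove[OF J(1) b(1)] poly_add poly_sum using other by (simp del: poly_smult)
    also have "\<dots> = poly p (c b)"
      using poly_pderiv_prod_linear_root(1,2)[OF J(1) b(1) J(2)] unfolding y_def by simp
    finally show "poly p x = poly ?q x" using b by simp
  qed
qed simp

text \<open>Differentiation in the coordinate \<open>(a, b)\<close> produces Kronecker deltas; this
  extracts the one surviving term from a double sum whose inner range depends on the outer
  index.\<close>

lemma sum_sum_of_bool_pair:
  fixes f :: "'a \<Rightarrow> 'b \<Rightarrow> 'c::semiring_1"
  assumes "finite I" "\<And>i. finite (J i)"
  shows "(\<Sum>i\<in>I. \<Sum>j\<in>J i. of_bool ((i, j) = (a, b)) * f i j)
    = (if a \<in> I \<and> b \<in> J a then f a b else 0)"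
proof -
  have "(\<Sum>i\<in>I. \<Sum>j\<in>J i. of_bool ((i, j) = (a, b)) * f i j)
      = (\<Sum>i\<in>I. if i = a then (\<Sum>j\<in>J i. if j = b then f i j else 0) else 0)"
    by (intro sum.cong refl) (auto intro!: sum.cong sum.neutral)
  also have "\<dots> = (if a \<in> I \<and> b \<in> J a then f a b else 0)"
    using assms by (simp add: sum.delta)
  finally show ?thesis .
qed

text \<open>Each pair containing \<open>b\<close> occurs once, as \<open>(b, k)\<close> with
  \<open>k > b\<close> or as \<open>(j, b)\<close> with \<open>j < b\<close>. In the second case
  numerator and denominator both change sign, so all terms take the same form.\<close>

lemma sum_pairs_of_bool:
  fixes x :: "nat \<Rightarrow> complex"
  assumes b: "b \<in> {1..n}"
  shows "(\<Sum>j\<in>{1..n}. \<Sum>k\<in>{j<..n}. 2 * ((of_bool (j = b) - of_bool (k = b)) / (x j - x k)))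
    = (\<Sum>k\<in>{1..n} - {b}. 2 / (x b - x k))"
proof -
  have "(\<Sum>j\<in>{1..n}. \<Sum>k\<in>{j<..n}. 2 * ((of_bool (j = b) - of_bool (k = b)) / (x j - x k)))
      = (\<Sum>j\<in>{1..n}. if j = b then \<Sum>k\<in>{j<..n}. 2 / (x j - x k) else 0)
        + (\<Sum>j\<in>{1..n}. \<Sum>k\<in>{j<..n}. if k = b then 2 / (x k - x j) else 0)"
  proof -
    have "2 * ((of_bool (j = b) - of_bool (k = b)) / (x j - x k))
        = (if j = b then 2 / (x j - x k) else 0) + (if k = b then 2 / (x k - x j) else 0)"
      if "k \<in> {j<..n}" for j k
      using that minus_divide_right[of 2 "x j - x k"] by auto
    then show ?thesis
      unfolding sum.distrib[symmetric] by (intro sum.cong refl) (simp add: sum.distrib)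
  qed
  also have "(\<Sum>j\<in>{1..n}. if j = b then \<Sum>k\<in>{j<..n}. 2 / (x j - x k) else 0)
      = (\<Sum>k\<in>{b<..n}. 2 / (x b - x k))" using b by simp
  also have "(\<Sum>j\<in>{1..n}. \<Sum>k\<in>{j<..n}. if k = b then 2 / (x k - x j) else 0)
      = (\<Sum>j\<in>{1..n}. if j < b then 2 / (x b - x j) else 0)"
    using b by (intro sum.cong refl) (simp add: sum.delta)
  also have "\<dots> = (\<Sum>j\<in>{1..<b}. 2 / (x b - x j))"
    using b by (intro sum.mono_neutral_cong_right) auto
  also have "(\<Sum>k\<in>{b<..n}. 2 / (x b - x k)) + (\<Sum>j\<in>{1..<b}. 2 / (x b - x j))
      = (\<Sum>k\<in>{b<..n} \<union> {1..<b}. 2 / (x b - x k))"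
    by (rule sum.union_disjoint[symmetric]) auto
  also have "{b<..n} \<union> {1..<b} = {1..n} - {b}" using b by auto
  finally show ?thesis .
qed

section \<open>The master function and its partial derivatives\<close>

lemma Rt_openD:
  assumes "t \<in> Rt_open N l Z" "i \<in> {1..N}"
  shows "inj_on (\<lambda>j. t (i, j)) {1..nat (l i)}"
    and "j \<in> {1..nat (l i)} \<Longrightarrow> t (i, j) \<notin> Z"
    and "i < N \<Longrightarrow> j \<in> {1..nat (l i)} \<Longrightarrow> k \<in> {1..nat (l (i + 1))} \<Longrightarrow> t (i, j) \<noteq> t (i + 1, k)"
  using assms unfolding Rt_open_def by blast+

lemma Rt_index_iff: "(i, j) \<in> Rt_index N l \<longleftrightarrow> i \<in> {1..N} \<and> j \<in> {1..nat (l i)}"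
  by (auto simp: Rt_index_def)

lemma master_fun_nonzero:
  assumes "\<forall>i\<in>{1..N}. \<forall>x. poly (T i) x = 0 \<longrightarrow> x \<in> Z" and t: "t \<in> Rt_open N l Z"
  shows "master_fun N l T t \<noteq> 0"
proof -
  have "t (i, j) \<noteq> t (i, k)" if "i \<in> {1..N}" "j \<in> {1..nat (l i)}" "k \<in> {j<..nat (l i)}" for i j k
    using Rt_openD(1)[OF t that(1)] that by (auto dest: inj_onD)
  then show ?thesis
    unfolding master_fun_def using Rt_openD(2,3)[OF t] assms(1) by (fastforce simp del: One_nat_def)
qed

lemma poly_y_poly_nonzero_neighbour:
  assumes t: "t \<in> Rt_open N l Z" and i: "i \<in> {1..N}" and j: "j \<in> {1..nat (l i)}"
  shows "poly (y_poly N l t (i - 1)) (t (i, j)) \<noteq> 0"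
    and "poly (y_poly N l t (i + 1)) (t (i, j)) \<noteq> 0"
proof -
  show "poly (y_poly N l t (i + 1)) (t (i, j)) \<noteq> 0"
    using Rt_openD(3)[OF t i _ j] unfolding poly_y_poly_eq_0_iff by force
  show "poly (y_poly N l t (i - 1)) (t (i, j)) \<noteq> 0"
    unfolding poly_y_poly_eq_0_iff
  proof
    assume *: "i - 1 \<in> {1..N} \<and> t (i, j) \<in> (\<lambda>k. t (i - 1, k)) ` {1..nat (l (i - 1))}"
    then have "i - 1 < N" "i - 1 + 1 = i" using i by auto
    then show False using * Rt_openD(3)[OF t, of "i - 1" _ j] j by force
  qed
qed

lemma poly_pderiv_y_poly:
  assumes "poly (y_poly N l t i) x \<noteq> 0"
  shows "poly (pderiv (y_poly N l t i)) x / poly (y_poly N l t i) x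
    = (if i \<in> {1..N} then \<Sum>j\<in>{1..nat (l i)}. 1 / (x - t (i, j)) else 0)"
proof (cases "i \<in> {1..N}")
  case True
  then have "x \<noteq> t (i, j)" if "j \<in> {1..nat (l i)}" for j
    using assms that unfolding poly_y_poly_eq_0_iff by blast
  then show ?thesis
    using poly_pderiv_prod_linear[of "{1..nat (l i)}" x "\<lambda>j. t (i, j)"] True assms
    by (simp add: y_poly_def)
next
  case False
  then show ?thesis by (auto simp: y_poly_def)
qed

text \<open>The logarithmic derivative is \<open>S1 + S2 + S3\<close>, one sum for each kind of
  factor. The factors with \<open>T\<close> give minus the logarithmic derivative of
  \<open>T a\<close>, the mixed differences give minus those of \<open>y (a - 1)\<close> and
  \<open>y (a + 1)\<close>, and the squared differences give \<open>y_a'' / y_a'\<close>.\<close>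

lemma partial_deriv_master_fun:
  assumes T: "\<forall>i\<in>{1..N}. \<forall>x. poly (T i) x = 0 \<longrightarrow> x \<in> Z"
    and t: "t \<in> Rt_open N l Z" and ab: "(a, b) \<in> Rt_index N l"
  defines "y \<equiv> y_poly N l t" and "x \<equiv> t (a, b)"
  defines "Q \<equiv> T a * y (a - 1) * y (a + 1)"
  shows "poly Q x \<noteq> 0" and "poly (pderiv (y a)) x \<noteq> 0"
    and "partial_deriv (a, b) (master_fun N l T) t
      = - master_fun N l T t * inverse (poly (pderiv (y a)) x * poly Q x)
        * poly (Wr (pderiv (y a)) Q) x"
proof -
  have a: "a \<in> {1..N}" and b: "b \<in> {1..nat (l a)}" using ab by (simp_all add: Rt_index_iff)
  \<comment> \<open>The derivative of the coordinate \<open>(i, j)\<close> in the direction of the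
    coordinate \<open>(a, b)\<close>.\<close>
  define \<delta> :: "nat \<Rightarrow> nat \<Rightarrow> complex" where "\<delta> = (\<lambda>i j. of_bool ((i, j) = (a, b)))"
  have coord: "((\<lambda>u. (t((a, b) := u)) (i, j)) has_field_derivative \<delta> i j) (at x)" for i j
    by (cases "(i, j) = (a, b)") (auto simp: \<delta>_def intro!: derivative_eq_intros)
  have upd: "(t((a, b) := x)) = t" by (simp add: x_def)
  have diff: "has_log_deriv (\<lambda>u. (t((a, b) := u)) (i, j) - (t((a, b) := u)) (i', j'))
      ((\<delta> i j - \<delta> i' j') / (t (i, j) - t (i', j'))) x" if "t (i, j) \<noteq> t (i', j')" for i j i' j'
    using has_log_derivI[OF DERIV_diff[OF coord coord], of i j i' j'] that unfolding upd by simp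
  have Tfac: "has_log_deriv (\<lambda>u. inverse (poly (T i) ((t((a, b) := u)) (i, j))))
      (- (poly (pderiv (T i)) (t (i, j)) * \<delta> i j / poly (T i) (t (i, j)))) x"
    if "i \<in> {1..N}" "j \<in> {1..nat (l i)}" for i j
  proof -
    have nz: "poly (T i) (t (i, j)) \<noteq> 0" using T Rt_openD(2)[OF t that(1)] that by blast
    have "((\<lambda>u. poly (T i) ((t((a, b) := u)) (i, j))) has_field_derivative
        poly (pderiv (T i)) ((t((a, b) := x)) (i, j)) * \<delta> i j) (at x)"
      by (rule DERIV_chain2[OF poly_DERIV coord])
    then have "has_log_deriv (\<lambda>u. poly (T i) ((t((a, b) := u)) (i, j)))
      (poly (pderiv (T i)) (t (i, j)) * \<delta> i j / poly (T i) (t (i, j))) x"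
      using has_log_derivI[of "\<lambda>u. poly (T i) ((t((a, b) := u)) (i, j))" _ x] nz unfolding upd by simp
    then show ?thesis using nz by (intro has_log_deriv_inverse) (auto simp: upd)
  qed
  have cross: "has_log_deriv (\<lambda>u. inverse ((t((a, b) := u)) (i, j) - (t((a, b) := u)) (i + 1, k)))
      (- ((\<delta> i j - \<delta> (i + 1) k) / (t (i, j) - t (i + 1, k)))) x"
    if "i \<in> {1..<N}" "j \<in> {1..nat (l i)}" "k \<in> {1..nat (l (i + 1))}" for i j k
  proof -
    have "t (i, j) \<noteq> t (i + 1, k)" using Rt_openD(3)[OF t, of i j k] that by auto
    then show ?thesis using diff by (intro has_log_deriv_inverse) (auto simp only: upd right_minus_eq)
  qed
  have self: "has_log_deriv (\<lambda>u. ((t((a, b) := u)) (i, j) - (t((a, b) := u)) (i, k))\<^sup>2)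
      (2 * ((\<delta> i j - \<delta> i k) / (t (i, j) - t (i, k)))) x"
    if "i \<in> {1..N}" "j \<in> {1..nat (l i)}" "k \<in> {j<..nat (l i)}" for i j k
  proof -
    have "t (i, j) \<noteq> t (i, k)" using Rt_openD(1)[OF t that(1)] that by (auto dest: inj_onD)
    then show ?thesis using diff by (intro has_log_deriv_power2) blast
  qed
  define S1 where "S1 = (\<Sum>i\<in>{1..N}. \<Sum>j\<in>{1..nat (l i)}.
      - (poly (pderiv (T i)) (t (i, j)) * \<delta> i j / poly (T i) (t (i, j))))"
  define S2 where "S2 = (\<Sum>i\<in>{1..<N}. \<Sum>j\<in>{1..nat (l i)}. \<Sum>k\<in>{1..nat (l (i + 1))}.
      - ((\<delta> i j - \<delta> (i + 1) k) / (t (i, j) - t (i + 1, k))))"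
  define S3 where "S3 = (\<Sum>i\<in>{1..N}. \<Sum>j\<in>{1..nat (l i)}. \<Sum>k\<in>{j<..nat (l i)}.
      2 * ((\<delta> i j - \<delta> i k) / (t (i, j) - t (i, k))))"
  have "has_log_deriv (\<lambda>u. master_fun N l T (t((a, b) := u))) (S1 + S2 + S3) x"
    unfolding master_fun_def S1_def S2_def S3_def
    by (intro has_log_deriv_mult has_log_deriv_prod Tfac cross self)
  then have deriv: "partial_deriv (a, b) (master_fun N l T) t = master_fun N l T t * (S1 + S2 + S3)"
    unfolding partial_deriv_def has_log_deriv_def x_def[symmetric] upd by (rule DERIV_imp_deriv)

  have "S1 = (\<Sum>i\<in>{1..N}. \<Sum>j\<in>{1..nat (l i)}. of_bool ((i, j) = (a, b))
      * (- (poly (pderiv (T i)) (t (i, j)) / poly (T i) (t (i, j)))))"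
    unfolding S1_def \<delta>_def by (intro sum.cong refl) simp
  also have "\<dots> = - (poly (pderiv (T a)) x / poly (T a) x)"
    using a b by (subst sum_sum_of_bool_pair) (auto simp: x_def)
  finally have S1: "S1 = - (poly (pderiv (T a)) x / poly (T a) x)" .

  have yp: "poly (y (a + 1)) x \<noteq> 0" and ym: "poly (y (a - 1)) x \<noteq> 0"
    unfolding y_def x_def using poly_y_poly_nonzero_neighbour[OF t a b] by blast+
  \<comment> \<open>A mixed factor involves the moving coordinate either on its left, when
    \<open>i = a\<close>, or on its right, when \<open>i = a - 1\<close>. For \<open>a = 1\<close>
    the truncated index \<open>a - 1 = 0\<close> lies outside the range, as it should.\<close>
  have "S2 = (\<Sum>i\<in>{1..<N}. \<Sum>j\<in>{1..nat (l i)}. of_bool ((i, j) = (a, b))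
        * (- (\<Sum>k\<in>{1..nat (l (i + 1))}. 1 / (t (i, j) - t (i + 1, k)))))
      + (\<Sum>i\<in>{1..<N}. \<Sum>k\<in>{1..nat (l (i + 1))}. of_bool ((i, k) = (a - 1, b))
        * (- (\<Sum>j\<in>{1..nat (l i)}. 1 / (t (i + 1, k) - t (i, j)))))"
  proof -
    have "(\<Sum>j\<in>{1..nat (l i)}. \<Sum>k\<in>{1..nat (l (i + 1))}.
        - ((\<delta> i j - \<delta> (i + 1) k) / (t (i, j) - t (i + 1, k))))
      = (\<Sum>j\<in>{1..nat (l i)}. of_bool ((i, j) = (a, b))
        * (- (\<Sum>k\<in>{1..nat (l (i + 1))}. 1 / (t (i, j) - t (i + 1, k)))))
      + (\<Sum>k\<in>{1..nat (l (i + 1))}. of_bool ((i, k) = (a - 1, b))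
        * (- (\<Sum>j\<in>{1..nat (l i)}. 1 / (t (i + 1, k) - t (i, j)))))" if i: "i \<in> {1..<N}" for i
    proof -
      have "(i + 1, k) = (a, b) \<longleftrightarrow> (i, k) = (a - 1, b)" for k using i by auto
      then have \<delta>: "\<delta> (i + 1) k = of_bool ((i, k) = (a - 1, b))" for k by (simp add: \<delta>_def)
      \<comment> \<open>The second difference is reversed so that in both terms the moving
        coordinate comes first, as in the expansion of \<open>y' / y\<close>.\<close>
      have split: "- ((p - q) / (r - s)) = p * (- (1 / (r - s))) + q * (- (1 / (s - r)))"
        for p q r s :: complex
      proof -
        have "q / (s - r) = - (q / (r - s))" using minus_divide_right[of q "r - s"] by simp
        then show ?thesis by (simp add: diff_divide_distrib)
      qed
      have "- ((\<delta> i j - \<delta> (i + 1) k) / (t (i, j) - t (i + 1, k)))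
          = of_bool ((i, j) = (a, b)) * (- (1 / (t (i, j) - t (i + 1, k))))
            + of_bool ((i, k) = (a - 1, b)) * (- (1 / (t (i + 1, k) - t (i, j))))" for j k
        unfolding split \<delta> by (simp add: \<delta>_def)
      then have "(\<Sum>j\<in>{1..nat (l i)}. \<Sum>k\<in>{1..nat (l (i + 1))}.
          - ((\<delta> i j - \<delta> (i + 1) k) / (t (i, j) - t (i + 1, k))))
        = (\<Sum>j\<in>{1..nat (l i)}. \<Sum>k\<in>{1..nat (l (i + 1))}.
            of_bool ((i, j) = (a, b)) * (- (1 / (t (i, j) - t (i + 1, k)))))
          + (\<Sum>j\<in>{1..nat (l i)}. \<Sum>k\<in>{1..nat (l (i + 1))}.
            of_bool ((i, k) = (a - 1, b)) * (- (1 / (t (i + 1, k) - t (i, j)))))"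
        by (simp only: sum.distrib)
      also have "(\<Sum>j\<in>{1..nat (l i)}. \<Sum>k\<in>{1..nat (l (i + 1))}.
            of_bool ((i, k) = (a - 1, b)) * (- (1 / (t (i + 1, k) - t (i, j)))))
          = (\<Sum>k\<in>{1..nat (l (i + 1))}. \<Sum>j\<in>{1..nat (l i)}.
            of_bool ((i, k) = (a - 1, b)) * (- (1 / (t (i + 1, k) - t (i, j)))))"
        by (rule sum.swap)
      finally show ?thesis unfolding sum_distrib_left[symmetric] sum_negf .
    qed
    then show ?thesis unfolding S2_def sum.distrib[symmetric] by (intro sum.cong refl)
  qed
  \<comment> \<open>For \<open>a = N\<close> the left side is zero because \<open>N\<close> is
    outside \<open>{1..<N}\<close>, and the right side because \<open>y (N + 1) = 1\<close>.\<close>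
  also have "(\<Sum>i\<in>{1..<N}. \<Sum>j\<in>{1..nat (l i)}. of_bool ((i, j) = (a, b))
        * (- (\<Sum>k\<in>{1..nat (l (i + 1))}. 1 / (t (i, j) - t (i + 1, k)))))
      = - (poly (pderiv (y (a + 1))) x / poly (y (a + 1)) x)"
    using a b poly_pderiv_y_poly[OF yp[unfolded y_def]] unfolding y_def
    by (subst sum_sum_of_bool_pair) (auto simp: x_def)
  also have "(\<Sum>i\<in>{1..<N}. \<Sum>k\<in>{1..nat (l (i + 1))}. of_bool ((i, k) = (a - 1, b))
        * (- (\<Sum>j\<in>{1..nat (l i)}. 1 / (t (i + 1, k) - t (i, j)))))
      = - (poly (pderiv (y (a - 1))) x / poly (y (a - 1)) x)"
  proof -
    \<comment> \<open>For \<open>a = 1\<close> both conditions fail, and correspondingly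
      \<open>y 0 = 1\<close> has derivative zero.\<close>
    have "a - 1 \<in> {1..<N} \<and> b \<in> {1..nat (l (a - 1 + 1))} \<longleftrightarrow> a - 1 \<in> {1..N}"
      using a b by (cases "a = 1") auto
    moreover have "a - 1 + 1 = a" using a by simp
    ultimately show ?thesis
      using poly_pderiv_y_poly[OF ym[unfolded y_def]] unfolding y_def
      by (subst sum_sum_of_bool_pair) (auto simp: x_def)
  qed
  finally have S2: "S2 = - (poly (pderiv (y (a + 1))) x / poly (y (a + 1)) x)
      + - (poly (pderiv (y (a - 1))) x / poly (y (a - 1)) x)" .

  have ya: "y a = (\<Prod>j\<in>{1..nat (l a)}. [:- t (a, j), 1:])" using a by (simp add: y_def y_poly_def)
  note root = poly_pderiv_prod_linear_root[OF finite_atLeastAtMost b Rt_openD(1)[OF t a],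
      folded ya x_def]
  show y'nz: "poly (pderiv (y a)) x \<noteq> 0" by (rule root(1))
  have "S3 = (\<Sum>i\<in>{1..N}. if i = a then \<Sum>j\<in>{1..nat (l i)}. \<Sum>k\<in>{j<..nat (l i)}.
      2 * ((of_bool (j = b) - of_bool (k = b)) / (t (i, j) - t (i, k))) else 0)"
    unfolding S3_def \<delta>_def by (intro sum.cong refl) (auto intro!: sum.cong sum.neutral)
  also have "\<dots> = (\<Sum>j\<in>{1..nat (l a)}. \<Sum>k\<in>{j<..nat (l a)}.
      2 * ((of_bool (j = b) - of_bool (k = b)) / (t (a, j) - t (a, k))))"
    using a by simp
  also have "\<dots> = (\<Sum>k\<in>{1..nat (l a)} - {b}. 2 / (x - t (a, k)))"
    unfolding x_def by (rule sum_pairs_of_bool[OF b])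
  also have "\<dots> = poly (pderiv (pderiv (y a))) x / poly (pderiv (y a)) x"
    using root(1,3) by simp
  finally have S3: "S3 = poly (pderiv (pderiv (y a))) x / poly (pderiv (y a)) x" .

  have Tnz: "poly (T a) x \<noteq> 0" using T a Rt_openD(2)[OF t a b] unfolding x_def by blast
  then show Qnz: "poly Q x \<noteq> 0" using yp ym by (simp add: Q_def)
  have "poly (pderiv Q) x / poly Q x = poly (pderiv (T a)) x / poly (T a) x
      + poly (pderiv (y (a - 1))) x / poly (y (a - 1)) x
      + poly (pderiv (y (a + 1))) x / poly (y (a + 1)) x"
    unfolding Q_def using Tnz yp ym by (simp add: pderiv_mult field_simps)
  then have "S1 + S2 + S3
      = poly (pderiv (pderiv (y a))) x / poly (pderiv (y a)) x - poly (pderiv Q) x / poly Q x"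
    unfolding S1 S2 S3 by simp
  also have "\<dots> = - (inverse (poly (pderiv (y a)) x * poly Q x) * poly (Wr (pderiv (y a)) Q) x)"
    unfolding Wr_def using y'nz Qnz by (simp add: field_simps)
  finally show "partial_deriv (a, b) (master_fun N l T) t
      = - master_fun N l T t * inverse (poly (pderiv (y a)) x * poly Q x)
        * poly (Wr (pderiv (y a)) Q) x"
    unfolding deriv by simp
qed

section \<open>Equality of the two subschemes\<close>

text \<open>The condition on the roots makes the values of \<open>T i\<close> at the coordinates
  units on \<open>Rt_open\<close>, so the master function is itself regular and invertible
  there.\<close>

lemma At_scheme_eq_At'_scheme:
  assumes T: "\<forall>i\<in>{1..N}. \<forall>x. poly (T i) x = 0 \<longrightarrow> x \<in> Z"
  shows "At_scheme N l Z T = At'_scheme N l Z T"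
proof -
  define U where "U = Rt_open N l Z"
  define F where "F = regular_affine (Rt_index N l) U"
  define V where "V = R_open N l Z"
  define G where "G = regular_R N l V"
  interpret A: function_algebra U F unfolding F_def by (rule function_algebra_regular_affine)
  interpret B: function_algebra V G unfolding G_def by (rule function_algebra_regular_R)
  have U: "{t \<in> Rt_space N l. Gamma_map N l t \<in> V} = U"
  proof -
    have "Rt_open N l Z \<subseteq> Rt_space N l" unfolding Rt_open_def by (rule Collect_restrict)
    then show ?thesis unfolding U_def V_def using Gamma_map_in_R_open_iff by blast
  qed
  \<comment> \<open>The tuple \<open>y\<close> is kept as an argument, since the same remainder is
    taken for the monic representatives on \<open>V\<close> and for the \<open>y_poly\<close> on
    \<open>U\<close>.\<close>
  define rem where "rem = (\<lambda>(y :: nat \<Rightarrow> complex poly) i.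
    Wr (pderiv (y i)) (T i * y (i - 1) * y (i + 1)) mod y i)"
  define S where "S = {(\<lambda>\<eta>\<in>V. coeff (rem (monic_rep N \<eta>) i) k) | i k. i \<in> {1..N}}"
  define r where "r = (\<lambda>t. rem (y_poly N l t))"
  define G1 where "G1 = {(\<lambda>t\<in>U. coeff (r t i) k) | i k. i \<in> {1..N}}"
  define G2 where "G2 = {(\<lambda>t\<in>U. partial_deriv v (master_fun N l T) t) | v. v \<in> Rt_index N l}"

  \<comment> \<open>Regularity of the equations on \<open>R_open\<close>\<close>
  have "S \<subseteq> G"
  proof -
    have VR: "V \<subseteq> R_space N l" by (auto simp: V_def R_open_def)
    have deg: "int (degree (monic_rep N \<eta> i)) = l i" if "\<eta> \<in> V" "i \<in> {1..N}" for \<eta> i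
      using that unfolding V_def R_open_def Let_def by blast
    have deg': "degree (monic_rep N \<eta> i) \<le> nat (l i)" if "\<eta> \<in> V" for \<eta> i
      using deg[OF that, of i] by (cases "i \<in> {1..N}") (auto simp: monic_rep_def)
    have preg: "B.preg (\<lambda>\<eta>. monic_rep N \<eta> i)" for i
    proof (cases "i \<in> {1..N}")
      case True
      then show ?thesis
        unfolding B.preg_def B.reg_def unfolding G_def
        using regular_R_coeff_monic_rep[OF VR deg] by blast
    next
      case False
      then have "monic_rep N \<eta> i = 1" for \<eta> by (auto simp: monic_rep_def)
      then show ?thesis by simp
    qed
    have "B.preg (\<lambda>\<eta>. rem (monic_rep N \<eta>) i)" if i: "i \<in> {1..N}" for i
      unfolding rem_def using lead_coeff_monic_rep VR deg[OF _ i] deg'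
      by (intro B.preg_Wr_mod[where e = "nat (l i)"] preg) (force, blast+)
    then show ?thesis by (auto simp: S_def B.preg_def B.reg_def)
  qed

  \<comment> \<open>Reduction of both schemes to explicit generators over \<open>U\<close>\<close>
  have "A_scheme N l Z T = (V, Idl\<^bsub>function_ring V G\<^esub> S)"
    by (simp add: A_scheme_def closed_subscheme_def S_def rem_def V_def G_def Let_def)
  then have "At_scheme N l Z T = (U, Idl\<^bsub>function_ring U F\<^esub>
      {(\<lambda>t\<in>U. f (Gamma_map N l t)) | f. f \<in> Idl\<^bsub>function_ring V G\<^esub> S})"
    unfolding At_scheme_def Gamma_preimage_def closed_subscheme_def Let_def
    by (simp only: fst_conv snd_conv U F_def)
  also have "Idl\<^bsub>function_ring U F\<^esub> {(\<lambda>t\<in>U. f (Gamma_map N l t)) | f.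
      f \<in> Idl\<^bsub>function_ring V G\<^esub> S}
    = Idl\<^bsub>function_ring U F\<^esub> {(\<lambda>t\<in>U. f (Gamma_map N l t)) | f. f \<in> S}"
  proof (rule genideal_pullback[OF A.function_algebra_axioms B.function_algebra_axioms _ _ \<open>S \<subseteq> G\<close>])
    show UV: "Gamma_map N l t \<in> V" if "t \<in> U" for t using U that by blast
    show "(\<lambda>t\<in>U. f (Gamma_map N l t)) \<in> F" if "f \<in> G" for f
      using that UV unfolding F_def G_def by (rule regular_affine_pullback)
  qed
  also have "{(\<lambda>t\<in>U. f (Gamma_map N l t)) | f. f \<in> S} = G1"
  proof -
    have "(\<lambda>t\<in>U. (\<lambda>\<eta>\<in>V. coeff (rem (monic_rep N \<eta>) i) k) (Gamma_map N l t))
        = (\<lambda>t\<in>U. coeff (r t i) k)" for i k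
      using U by (intro restrict_ext) (auto simp: r_def monic_rep_Gamma_map)
    then show ?thesis unfolding S_def G1_def by (auto, metis+)
  qed
  finally have At: "At_scheme N l Z T = (U, Idl\<^bsub>function_ring U F\<^esub> G1)" .
  have At': "At'_scheme N l Z T = (U, Idl\<^bsub>function_ring U F\<^esub> G2)"
    by (simp add: At'_scheme_def closed_subscheme_def U_def F_def G2_def)

  \<comment> \<open>Regular functions and units on \<open>U\<close>\<close>
  have reg_inverse: "A.reg (\<lambda>t. inverse (f t))" if "A.reg f" "\<And>t. t \<in> U \<Longrightarrow> f t \<noteq> 0" for f
    using that regular_affine_inverse[of f U] unfolding A.reg_def unfolding F_def by blast
  have reg_t: "A.reg (\<lambda>t. t v)" if "v \<in> Rt_index N l" for v
    unfolding A.reg_def unfolding F_def by (intro regular_affine_if_poly_funs poly_funs.coord that)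
  have preg_y: "A.preg (\<lambda>t. y_poly N l t i)" for i
    unfolding A.preg_def A.reg_def unfolding F_def
    by (intro allI regular_affine_if_poly_funs poly_funs_coeff_y_poly)
  have deg_y: "degree (y_poly N l t i) \<le> nat (l i)" for t i
    by (cases "i \<in> {1..N}") (simp add: degree_y_poly, auto simp: y_poly_def)
  have reg_\<Phi>: "A.reg (master_fun N l T)"
  proof -
    have "A.reg (\<lambda>t. inverse (poly (T i) (t (i, j))))" if "i \<in> {1..N}" "j \<in> {1..nat (l i)}" for i j
    proof (intro reg_inverse A.reg_poly[where m = "degree (T i)"] A.preg_const reg_t)
      show "poly (T i) (t (i, j)) \<noteq> 0" if "t \<in> U" for t
        using T Rt_openD(2)[of t N l Z i j] that \<open>i \<in> _\<close> \<open>j \<in> _\<close> unfolding U_def by blast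
    qed (use that in \<open>simp_all add: Rt_index_iff\<close>)
    moreover have "A.reg (\<lambda>t. inverse (t (i, j) - t (i + 1, k)))"
      if "i \<in> {1..<N}" "j \<in> {1..nat (l i)}" "k \<in> {1..nat (l (i + 1))}" for i j k
    proof (intro reg_inverse A.reg_diff reg_t)
      show "(i, j) \<in> Rt_index N l" "(i + 1, k) \<in> Rt_index N l" using that by (auto simp: Rt_index_iff)
      show "t (i, j) - t (i + 1, k) \<noteq> 0" if "t \<in> U" for t
        using Rt_openD(3)[of t N l Z i j k] that \<open>i \<in> _\<close> \<open>j \<in> _\<close> \<open>k \<in> _\<close> by (simp add: U_def)
    qed
    moreover have "A.reg (\<lambda>t. (t (i, j) - t (i, k))\<^sup>2)"
      if "i \<in> {1..N}" "j \<in> {1..nat (l i)}" "k \<in> {j<..nat (l i)}" for i j k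
      using that by (intro A.reg_power A.reg_diff reg_t) (auto simp: Rt_index_iff)
    ultimately show ?thesis
      unfolding master_fun_def by (intro A.reg_mult A.reg_prod)
  qed
  have preg_r: "A.preg (\<lambda>t. r t i)" if i: "i \<in> {1..N}" for i
  proof -
    have "degree (y_poly N l t i) = nat (l i) \<and> lead_coeff (y_poly N l t i) = 1" for t
      using degree_y_poly[OF i] lead_coeff_y_poly by blast
    then show ?thesis
      unfolding r_def rem_def by (rule A.preg_Wr_mod[OF preg_y preg_y preg_y _ deg_y deg_y])
  qed
  have deg_r: "r t i = 0 \<or> degree (r t i) < nat (l i)" if i: "i \<in> {1..N}" for t i
    using degree_mod_less[of "y_poly N l t i"] degree_y_poly[OF i] unfolding r_def rem_def by simp

  \<comment> \<open>The factor between a partial derivative of the master function and the value of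
    the remainder at the corresponding root. It is regular and nowhere zero on \<open>U\<close>,
    hence a unit.\<close>
  define h where "h = (\<lambda>(i, j) t. - master_fun N l T t
    * inverse (poly (pderiv (y_poly N l t i)) (t (i, j))
      * poly (T i * y_poly N l t (i - 1) * y_poly N l t (i + 1)) (t (i, j))))"
  have partial: "partial_deriv (i, j) (master_fun N l T) t = h (i, j) t * poly (r t i) (t (i, j))"
    and h_nz: "h (i, j) t \<noteq> 0" and y'_nz: "poly (pderiv (y_poly N l t i)) (t (i, j)) \<noteq> 0"
    and Q_nz: "poly (T i * y_poly N l t (i - 1) * y_poly N l t (i + 1)) (t (i, j)) \<noteq> 0"
    if "t \<in> U" "(i, j) \<in> Rt_index N l" for t i j
  proof -
    have t: "t \<in> Rt_open N l Z" using that by (simp add: U_def)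
    note * = partial_deriv_master_fun[OF T t that(2)]
    show Q: "poly (T i * y_poly N l t (i - 1) * y_poly N l t (i + 1)) (t (i, j)) \<noteq> 0"
      and y': "poly (pderiv (y_poly N l t i)) (t (i, j)) \<noteq> 0" using * by blast+
    show "h (i, j) t \<noteq> 0"
      using Q y' master_fun_nonzero[OF T t] unfolding h_def by (simp del: poly_mult)
    \<comment> \<open>At a root of \<open>y_i\<close> the Wronskian and its remainder modulo
      \<open>y_i\<close> have the same value.\<close>
    have "poly (y_poly N l t i) (t (i, j)) = 0"
      using that(2) unfolding poly_y_poly_eq_0_iff Rt_index_iff by blast
    then show "partial_deriv (i, j) (master_fun N l T) t = h (i, j) t * poly (r t i) (t (i, j))"
      using *(3) by (simp add: h_def r_def rem_def poly_mod del: poly_mult)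
  qed
  have reg_y': "A.reg (\<lambda>t. poly (pderiv (y_poly N l t i)) (t (i, j)))"
    if "(i, j) \<in> Rt_index N l" for i j
  proof (intro A.reg_poly A.preg_pderiv preg_y reg_t that)
    show "degree (pderiv (y_poly N l t i)) \<le> nat (l i)" for t
      using deg_y[of t i] by (simp add: degree_pderiv)
  qed
  have reg_h: "A.reg (h (i, j))" if ij: "(i, j) \<in> Rt_index N l" for i j
  proof -
    have "A.reg (\<lambda>t. poly (T i * y_poly N l t (i - 1) * y_poly N l t (i + 1)) (t (i, j)))"
      unfolding poly_mult using deg_y
      by (intro A.reg_mult A.reg_poly preg_y A.preg_const reg_t ij) auto
    then have "A.reg (\<lambda>t. - master_fun N l T t * inverse (poly (pderiv (y_poly N l t i)) (t (i, j))
        * poly (T i * y_poly N l t (i - 1) * y_poly N l t (i + 1)) (t (i, j))))"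
      using y'_nz[OF _ ij] Q_nz[OF _ ij]
      by (intro A.reg_mult A.reg_uminus reg_\<Phi> reg_inverse reg_y'[OF ij] no_zero_divisors) auto
    then show ?thesis by (simp add: h_def)
  qed

  \<comment> \<open>Partial derivatives lie in the ideal of the remainder coefficients\<close>
  have G1: "G1 \<subseteq> F" using preg_r by (auto simp: G1_def A.preg_def A.reg_def)
  have idl1: "ideal (Idl\<^bsub>function_ring U F\<^esub> G1) (function_ring U F)"
    by (rule A.ideal_genideal[OF G1])
  have "G2 \<subseteq> Idl\<^bsub>function_ring U F\<^esub> G1"
  proof
    fix g assume "g \<in> G2"
    then obtain i j where ij: "(i, j) \<in> Rt_index N l"
      and g: "g = (\<lambda>t\<in>U. partial_deriv (i, j) (master_fun N l T) t)" unfolding G2_def by auto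
    then have i: "i \<in> {1..N}" by (simp add: Rt_index_iff)
    \<comment> \<open>The value of the remainder at \<open>t (i, j)\<close> is expanded in powers of
      \<open>t (i, j)\<close>, up to an exponent independent of \<open>t\<close>, and multiplied by
      \<open>h\<close>.\<close>
    have "(\<lambda>t\<in>U. \<Sum>k\<le>nat (l i). (h (i, j) t * t (i, j) ^ k) * coeff (r t i) k)
        \<in> Idl\<^bsub>function_ring U F\<^esub> G1"
      using A.subset_genideal[OF G1] i
      by (intro A.ideal_linear_combination[OF idl1] A.reg_mult A.reg_power reg_h reg_t ij)
        (auto simp: G1_def)
    moreover have "(\<Sum>k\<le>nat (l i). (h (i, j) t * t (i, j) ^ k) * coeff (r t i) k)
        = partial_deriv (i, j) (master_fun N l T) t" if "t \<in> U" for t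
    proof -
      have "degree (r t i) \<le> nat (l i)" using deg_r[OF i, of t] by auto
      then show ?thesis
        unfolding partial[OF that ij] poly_altdef_le[OF \<open>degree (r t i) \<le> nat (l i)\<close>]
        by (simp add: sum_distrib_left mult_ac)
    qed
    ultimately show "g \<in> Idl\<^bsub>function_ring U F\<^esub> G1" unfolding g by (simp cong: restrict_cong)
  qed
  then have sub: "Idl\<^bsub>function_ring U F\<^esub> G2 \<subseteq> Idl\<^bsub>function_ring U F\<^esub> G1"
    by (rule A.genideal_subset[OF idl1])

  \<comment> \<open>Remainder coefficients lie in the ideal of the partial derivatives\<close>
  have G2: "G2 \<subseteq> F"
    using \<open>G2 \<subseteq> Idl\<^bsub>function_ring U F\<^esub> G1\<close> idl1 unfolding A.ideal_function_ring_iff by blast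
  have idl2: "ideal (Idl\<^bsub>function_ring U F\<^esub> G2) (function_ring U F)"
    by (rule A.ideal_genideal[OF G2])
  have "G1 \<subseteq> Idl\<^bsub>function_ring U F\<^esub> G2"
  proof
    fix g assume "g \<in> G1"
    then obtain i k where i: "i \<in> {1..N}" and g: "g = (\<lambda>t\<in>U. coeff (r t i) k)"
      unfolding G1_def by auto
    \<comment> \<open>The numerators of the Lagrange basis: \<open>y_i\<close> with its
      \<open>j\<close>-th linear factor removed.\<close>
    define L :: "nat \<Rightarrow> (nat \<times> nat \<Rightarrow> complex) \<Rightarrow> complex poly"
      where "L = (\<lambda>j t. \<Prod>m\<in>{1..nat (l i)} - {j}. [:- t (i, m), 1:])"
    have idx: "(i, j) \<in> Rt_index N l" if "j \<in> {1..nat (l i)}" for j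
      using that i by (simp add: Rt_index_iff)
    have reg_L: "A.reg (\<lambda>t. coeff (L j t) k)" if "j \<in> {1..nat (l i)}" for j
    proof -
      have "A.preg (L j)" unfolding L_def
        by (intro A.preg_prod A.preg_linear A.reg_uminus reg_t idx) auto
      then show ?thesis by (simp add: A.preg_def)
    qed
    \<comment> \<open>This is the coefficient of degree \<open>k\<close> in the interpolation
      formula for the remainder, with its value at \<open>t (i, j)\<close> replaced by the partial
      derivative divided by \<open>h (i, j)\<close>.\<close>
    have "(\<lambda>t\<in>U. \<Sum>j\<in>{1..nat (l i)}. (inverse (h (i, j) t)
          * inverse (poly (pderiv (y_poly N l t i)) (t (i, j))) * coeff (L j t) k)
        * partial_deriv (i, j) (master_fun N l T) t) \<in> Idl\<^bsub>function_ring U F\<^esub> G2"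
    proof (rule A.ideal_linear_combination[OF idl2])
      fix j assume j: "j \<in> {1..nat (l i)}"
      show "A.reg (\<lambda>t. inverse (h (i, j) t)
          * inverse (poly (pderiv (y_poly N l t i)) (t (i, j))) * coeff (L j t) k)"
        using h_nz y'_nz idx[OF j]
        by (intro A.reg_mult reg_inverse reg_h reg_y' reg_L j) auto
      show "(\<lambda>t\<in>U. partial_deriv (i, j) (master_fun N l T) t) \<in> Idl\<^bsub>function_ring U F\<^esub> G2"
        using A.subset_genideal[OF G2] idx[OF j] unfolding G2_def by blast
    qed
    moreover have "(\<Sum>j\<in>{1..nat (l i)}. (inverse (h (i, j) t)
          * inverse (poly (pderiv (y_poly N l t i)) (t (i, j))) * coeff (L j t) k)
        * partial_deriv (i, j) (master_fun N l T) t) = coeff (r t i) k" if t: "t \<in> U" for t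
    proof -
      have y: "(\<Prod>j\<in>{1..nat (l i)}. [:- t (i, j), 1:]) = y_poly N l t i"
        using i by (simp add: y_poly_def)
      have inj: "inj_on (\<lambda>j. t (i, j)) {1..nat (l i)}"
        using t i Rt_openD(1) by (simp add: U_def)
      have "r t i = (\<Sum>j\<in>{1..nat (l i)}. smult (poly (r t i) (t (i, j))
          * inverse (poly (pderiv (y_poly N l t i)) (t (i, j)))) (L j t))"
        using lagrange_interpolation[OF _ inj, of "r t i"] deg_r[OF i, of t] unfolding y L_def by simp
      from arg_cong[OF this, of "\<lambda>p. coeff p k"]
      have "coeff (r t i) k = (\<Sum>j\<in>{1..nat (l i)}. poly (r t i) (t (i, j))
          * inverse (poly (pderiv (y_poly N l t i)) (t (i, j))) * coeff (L j t) k)"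
        unfolding coeff_sum coeff_smult .
      also have "\<dots> = (\<Sum>j\<in>{1..nat (l i)}. (inverse (h (i, j) t)
          * inverse (poly (pderiv (y_poly N l t i)) (t (i, j))) * coeff (L j t) k)
        * partial_deriv (i, j) (master_fun N l T) t)"
      proof (rule sum.cong[OF refl])
        fix j assume "j \<in> {1..nat (l i)}"
        then have "h (i, j) t \<noteq> 0" "partial_deriv (i, j) (master_fun N l T) t
            = h (i, j) t * poly (r t i) (t (i, j))"
          using h_nz partial t idx by blast+
        then show "poly (r t i) (t (i, j))
            * inverse (poly (pderiv (y_poly N l t i)) (t (i, j))) * coeff (L j t) k
          = (inverse (h (i, j) t) * inverse (poly (pderiv (y_poly N l t i)) (t (i, j)))
            * coeff (L j t) k) * partial_deriv (i, j) (master_fun N l T) t" by simp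
      qed
      finally show ?thesis by simp
    qed
    ultimately show "g \<in> Idl\<^bsub>function_ring U F\<^esub> G2" unfolding g by (simp cong: restrict_cong)
  qed
  then have "Idl\<^bsub>function_ring U F\<^esub> G1 \<subseteq> Idl\<^bsub>function_ring U F\<^esub> G2"
    by (rule A.genideal_subset[OF idl2])
  then show ?thesis unfolding At At' using sub by simp
qed

theorem lemma3p4:
  fixes N d n :: nat
    and z :: "nat \<Rightarrow> complex"
    and a :: "nat \<Rightarrow> nat \<Rightarrow> nat"
    and ainf w :: "nat \<Rightarrow> nat"
  assumes "N \<le> d"
    and "inj_on z {1..n}"
    and "\<And>s. s \<in> {1..n} \<Longrightarrow> ramification_seq N d (a s)"
    and "ramification_seq N d ainf"
    and "(\<Sum>s=1..n. ram_size N (a s)) + ram_size N ainf = (N + 1) * (d - N)"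
    and "w permutes {1..N + 1}"
  shows "At_scheme N (lw N d n z a ainf w) (z ` {1..n}) (T_poly N n z a)
       = At'_scheme N (lw N d n z a ainf w) (z ` {1..n}) (T_poly N n z a)"
  \<comment> \<open>Each \<open>T_poly\<close> is a product of powers of the \<open>x - z s\<close>,
    so its roots are among the points \<open>z s\<close>.\<close>
  by (rule At_scheme_eq_At'_scheme) (auto simp: T_poly_def poly_prod)

end
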